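(* Let $\mathbb{R}^2_+=\mathbb{R}\times(0,+\infty)$ and let $v=(v^1,v^2):\overline{\mathbb{R}^2_+}\to\mathbb{R}^2$ be a $C^2(\overline{\mathbb{R}^2_+})$ vector field which, together with some scalar pressure function $p$, solves the steady Euler equations $$v\cdot\nabla v+\nabla p=0\quad\text{and}\quad \operatorname{div} v=0\quad\text{in }\mathbb{R}^2_+.$$ Suppose that $v^2=0$ on $\partial\mathbb{R}^2_+$ and that $$0<\inf_{\mathbb{R}^2_+}|v|\le\sup_{\mathbb{R}^2_+}|v|<+\infty.$$ Then $v$ is a shear flow, which means here that $v(x)=(v^1(x_2),0)$ in $\overline{\mathbb{R}^2_+}=\mathbb{R}\times[0,+\infty)$: the second component $v^2$ vanishes identically and the first component $v^1$ depends on the variable $x_2$ only. In particular, $v^1$ has a constant strict sign in $\overline{\mathbb{R}^2_+}$ (either $v^1>0$ everywhere or $v^1<0$ everywhere).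
   Context: $|\cdot|$ is the Euclidean norm. $C^2(\overline{\mathbb{R}^2_+})$ means that all partial derivatives up to order $2$ exist and are continuous up to the boundary. $v\cdot\nabla v$ is the vector field with components $\sum_j v^j\,\partial_{x_j}v^i$. The equations are understood in the classical pointwise sense. *)

theory Defs
  imports "HOL-Analysis.Analysis"
begin

definition partial_differentiable :: "'n \<Rightarrow> (real ^ 'n \<Rightarrow> real) \<Rightarrow> real ^ 'n \<Rightarrow> bool"
  where "partial_differentiable i f x \<longleftrightarrow>
           (\<lambda>t. f (x + t *\<^sub>R axis i 1)) field_differentiable (at 0)"

text \<open>Only meaningful where \<^const>\<open>partial_differentiable\<close> holds.\<close>

definition partial_deriv :: "'n \<Rightarrow> (real ^ 'n \<Rightarrow> real) \<Rightarrow> real ^ 'n \<Rightarrow> real"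
  where "partial_deriv i f x = deriv (\<lambda>t. f (x + t *\<^sub>R axis i 1)) 0"

text \<open>
  \<open>Ck_closure k U f\<close>: for an open set \<open>U\<close>, the function \<open>f\<close> belongs to \<open>C\<^sup>k\<close> of the closure of \<open>U\<close>.
  It is continuous on the closure, all partial derivatives of order at most \<open>k\<close> exist in \<open>U\<close>,
  and each of them extends continuously to the closure of \<open>U\<close>; the \<open>g\<close> below is such an extension.
  Values of \<open>f\<close> outside the closure of \<open>U\<close> are irrelevant.
\<close>

primrec Ck_closure :: "nat \<Rightarrow> (real ^ 'n) set \<Rightarrow> (real ^ 'n \<Rightarrow> real) \<Rightarrow> bool"
  where
    "Ck_closure 0 U f \<longleftrightarrow> continuous_on (closure U) f"
  | "Ck_closure (Suc k) U f \<longleftrightarrow>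
       continuous_on (closure U) f \<and>
       (\<forall>i. (\<forall>x\<in>U. partial_differentiable i f x) \<and>
            (\<exists>g. Ck_closure k U g \<and> (\<forall>x\<in>U. g x = partial_deriv i f x)))"

definition gradient :: "(real ^ 'n \<Rightarrow> real) \<Rightarrow> real ^ 'n \<Rightarrow> real ^ 'n"
  where "gradient p x = (\<chi> i. partial_deriv i p x)"

definition divergence :: "(real ^ 'n \<Rightarrow> real ^ 'n) \<Rightarrow> real ^ 'n \<Rightarrow> real"
  where "divergence v x = (\<Sum>i\<in>UNIV. partial_deriv i (\<lambda>y. v y $ i) x)"

text \<open>The vector field \<open>v \<cdot> \<nabla>v\<close>.\<close>

definition advection :: "(real ^ 'n \<Rightarrow> real ^ 'n) \<Rightarrow> real ^ 'n \<Rightarrow> real ^ 'n"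
  where "advection v x = (\<chi> i. \<Sum>j\<in>UNIV. v x $ j * partial_deriv j (\<lambda>y. v y $ i) x)"

text \<open>
  No regularity of the pressure is assumed beyond existence of its partial derivatives; when \<open>v\<close> is
  \<open>C\<^sup>1\<close> on the open set \<open>U\<close>, the first equation makes them continuous.
\<close>

definition steady_euler :: "(real ^ 'n) set \<Rightarrow> (real ^ 'n \<Rightarrow> real ^ 'n) \<Rightarrow> (real ^ 'n \<Rightarrow> real) \<Rightarrow> bool"
  where "steady_euler U v p \<longleftrightarrow>
           (\<forall>x\<in>U. (\<forall>i. partial_differentiable i p x) \<and>
                  advection v x + gradient p x = 0 \<and>
                  divergence v x = 0)"

definition half_plane :: "(real ^ 2) set"
  where "half_plane = {x. x $ 2 > 0}"

definition shear_flow_on :: "(real ^ 2) set \<Rightarrow> (real ^ 2 \<Rightarrow> real ^ 2) \<Rightarrow> bool"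
  where "shear_flow_on S v \<longleftrightarrow>
           (\<forall>x\<in>S. v x $ 2 = 0) \<and> (\<exists>u :: real \<Rightarrow> real. \<forall>x\<in>S. v x $ 1 = u (x $ 2))"

lemma half_plane_inner: "half_plane = {x. axis 2 1 \<bullet> x > 0}"
  by (simp add: half_plane_def inner_axis inner_commute)

lemma closure_half_plane: "closure half_plane = {x. x $ 2 \<ge> 0}"
proof -
  have "axis 2 (1::real) \<noteq> (0 :: real ^ 2)"
    by (simp add: axis_eq_0_iff)
  then show ?thesis
    unfolding half_plane_inner
    by (subst closure_halfspace_gt) (auto simp: inner_axis inner_commute)
qed

lemma frontier_half_plane: "frontier half_plane = {x. x $ 2 = 0}"
proof -
  have "axis 2 (1::real) \<noteq> (0 :: real ^ 2)"
    by (simp add: axis_eq_0_iff)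
  then show ?thesis
    unfolding half_plane_inner
    by (subst frontier_halfspace_gt) (auto simp: inner_axis inner_commute)
qed

end

theory Submission
  imports Defs
begin

text \<open>
  Let \<open>\<phi>\<close> be the argument of \<open>v\<close>, normalised to vanish on the wall. Euler's equations give
  \<open>|v|\<^sup>2 \<nabla>\<phi> = (- \<partial>\<^sub>2 p, \<partial>\<^sub>1 p)\<close>. This field is divergence free, and since \<open>\<nabla>p = - div (v \<otimes> v)\<close> its
  components are also first derivatives of bounded functions. Testing with \<open>\<eta> \<phi>\<close> for a cutoff \<open>\<eta>\<close> at
  scale \<open>R\<close> and integrating by parts twice leaves
  \<open>\<integral> \<eta> |\<nabla>\<phi>|\<^sup>2 \<le> C/R \<integral> sqrt \<eta> |\<nabla>\<phi>|\<close>, where terms containing \<open>\<phi>\<close> itself are controlled by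
  integrating \<open>\<partial>\<^sub>2 \<phi>\<close> from the wall. As the domain has area of order \<open>R\<^sup>2\<close>, this first shows that \<open>\<nabla>\<phi>\<close> is
  square integrable over the half plane; but then the right-hand side tends to 0 as \<open>R \<rightarrow> \<infinity>\<close>,
  so \<open>\<nabla>\<phi> = 0\<close>. Hence \<open>v\<close> is everywhere parallel to the wall, and \<open>div v = 0\<close> makes it a shear flow.
\<close>

subsection \<open>Calculus on the closed half plane\<close>

definition upper :: "(real \<times> real) set"
  where "upper = {z. 0 \<le> snd z}"

text \<open>Derivatives are carried as explicit functions, so that product and quotient rules can be
  chained and their output named. The tangential derivative is demanded on the wall too; the
  derivative across the wall only has to extend continuously to it.\<close>

definition C1_upper :: "(real \<times> real \<Rightarrow> real) \<Rightarrow> (real \<times> real \<Rightarrow> real) \<Rightarrow> (real \<times> real \<Rightarrow> real) \<Rightarrow> bool"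
  where "C1_upper f fx fy \<longleftrightarrow>
    continuous_on upper f \<and> continuous_on upper fx \<and> continuous_on upper fy \<and>
    (\<forall>x y. 0 \<le> y \<longrightarrow> ((\<lambda>s. f (s, y)) has_real_derivative fx (x, y)) (at x)) \<and>
    (\<forall>x y. 0 < y \<longrightarrow> ((\<lambda>t. f (x, t)) has_real_derivative fy (x, y)) (at y))"

lemma C1_upperD:
  assumes "C1_upper f fx fy"
  shows "continuous_on upper f" "continuous_on upper fx" "continuous_on upper fy"
    and "\<And>x y. 0 \<le> y \<Longrightarrow> ((\<lambda>s. f (s, y)) has_real_derivative fx (x, y)) (at x)"
    and "\<And>x y. 0 < y \<Longrightarrow> ((\<lambda>t. f (x, t)) has_real_derivative fy (x, y)) (at y)"
  using assms unfolding C1_upper_def by auto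

lemma continuous_on_slice_x:
  assumes "continuous_on upper f" "0 \<le> y"
  shows "continuous_on S (\<lambda>s. f (s, y))"
  by (rule continuous_on_compose2[OF assms(1)]) (use assms(2) in \<open>auto simp: upper_def intro!: continuous_intros\<close>)

lemma continuous_on_slice_y:
  assumes "continuous_on upper f"
  shows "continuous_on {0..} (\<lambda>t. f (x, t))"
  by (rule continuous_on_compose2[OF assms(1)]) (auto simp: upper_def intro!: continuous_intros)

text \<open>A wall point is a limit along its own vertical line. In this way bounds and identities
  known in the open half plane reach the wall.\<close>

lemma ge_on_upper:
  assumes "continuous_on upper f" and "\<And>z. 0 < snd z \<Longrightarrow> (c::real) \<le> f z" and "z \<in> upper"
  shows "c \<le> f z"
proof -
  obtain x y where z: "z = (x, y)" and y: "0 \<le> y"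
    using assms(3) by (cases z) (auto simp: upper_def)
  have "closure {0<..} = {0::real..}"
    by simp
  then have "c \<le> f (x, y)"
    by (intro continuous_ge_on_closure[of "{0<..}" "\<lambda>t. f (x, t)" y c])
       (use continuous_on_slice_y[OF assms(1)] y assms(2) in auto)
  then show ?thesis by (simp add: z)
qed

lemma eq_on_upper:
  fixes f g :: "real \<times> real \<Rightarrow> real"
  assumes f: "continuous_on upper f" and g: "continuous_on upper g"
    and "\<And>z. 0 < snd z \<Longrightarrow> f z = g z" and z: "z \<in> upper"
  shows "f z = g z"
proof -
  have "0 \<le> f z - g z"
    by (rule ge_on_upper[OF continuous_on_diff[OF f g] _ z]) (use assms(3) in auto)
  moreover have "0 \<le> g z - f z"
    by (rule ge_on_upper[OF continuous_on_diff[OF g f] _ z]) (use assms(3) in auto)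
  ultimately show ?thesis by simp
qed

text \<open>The derivative along the boundary is obtained by letting \<open>y \<rightarrow> 0\<close> in the integrated form.\<close>

lemma C1_upperI:
  assumes f: "continuous_on upper f" and fx: "continuous_on upper fx" and fy: "continuous_on upper fy"
    and dx: "\<And>x y. 0 < y \<Longrightarrow> ((\<lambda>s. f (s, y)) has_real_derivative fx (x, y)) (at x)"
    and dy: "\<And>x y. 0 < y \<Longrightarrow> ((\<lambda>t. f (x, t)) has_real_derivative fy (x, y)) (at y)"
  shows "C1_upper f fx fy"
proof -
  have inc: "f (x2, y) = f (x1, y) + integral {x1..x2} (\<lambda>s. fx (s, y))" if "x1 \<le> x2" "0 \<le> y" for x1 x2 y
  proof -
    define F where "F z = f (x2, snd z) - f (x1, snd z) - integral {x1..x2} (\<lambda>s. fx (s, snd z))"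
      for z :: "real \<times> real"
    have "continuous_on upper (\<lambda>z. integral (cbox x1 x2) (\<lambda>s. fx (s, snd z)))"
      by (rule integral_continuous_on_param)
         (auto simp: case_prod_beta upper_def intro!: continuous_on_compose2[OF fx] continuous_intros)
    then have "continuous_on upper F"
      unfolding F_def
      by (auto simp: upper_def intro!: continuous_intros continuous_on_compose2[OF f])
    moreover have "F z = 0" if "0 < snd z" for z
    proof -
      have "((\<lambda>s. fx (s, snd z)) has_integral (f (x2, snd z) - f (x1, snd z))) {x1..x2}"
        by (rule fundamental_theorem_of_calculus[OF \<open>x1 \<le> x2\<close>])
           (use dx[OF that] in \<open>auto simp flip: has_real_derivative_iff_has_vector_derivative
              intro: has_field_derivative_at_within\<close>)
      then show ?thesis by (simp add: F_def integral_unique)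
    qed
    ultimately have "F (0, y) = 0"
      using eq_on_upper[of F "\<lambda>_. 0" "(0, y)"] that by (auto simp: upper_def)
    then show ?thesis by (simp add: F_def)
  qed
  have "((\<lambda>s. f (s, y)) has_real_derivative fx (x, y)) (at x)" if y: "0 \<le> y" for x y
  proof -
    \<comment> \<open>Starting the integral at \<open>x - 1\<close> puts \<open>x\<close> inside the
      interval, so that the derivative within it is two-sided.\<close>
    have "((\<lambda>s. f (x - 1, y) + integral {x-1..s} (\<lambda>s. fx (s, y))) has_real_derivative 0 + fx (x, y))
            (at x within {x-1..x+1})"
      by (intro DERIV_add DERIV_const integral_has_real_derivative continuous_on_slice_x[OF fx y]) auto
    then have "((\<lambda>s. f (x - 1, y) + integral {x-1..s} (\<lambda>s. fx (s, y))) has_real_derivative fx (x, y))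
            (at x within {x-1..x+1})"
      by simp
    then have "((\<lambda>s. f (s, y)) has_real_derivative fx (x, y)) (at x within {x-1..x+1})"
      by (rule has_field_derivative_transform_within[where d=1])
         (auto simp: inc[of "x - 1" _ y, OF _ y, symmetric])
    then show ?thesis
      using at_within_interior[of x "{x-1..x+1}"] by (simp add: interior_atLeastAtMost_real)
  qed
  with f fx fy dy show ?thesis
    unfolding C1_upper_def by blast
qed

lemma C1_upper_add:
  assumes "C1_upper f fx fy" "C1_upper g gx gy"
  shows "C1_upper (\<lambda>z. f z + g z) (\<lambda>z. fx z + gx z) (\<lambda>z. fy z + gy z)"
  using assms unfolding C1_upper_def by (auto intro!: continuous_intros derivative_intros)

lemma C1_upper_diff:
  assumes "C1_upper f fx fy" "C1_upper g gx gy"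
  shows "C1_upper (\<lambda>z. f z - g z) (\<lambda>z. fx z - gx z) (\<lambda>z. fy z - gy z)"
  using assms unfolding C1_upper_def by (auto intro!: continuous_intros derivative_intros)

lemma C1_upper_mult:
  assumes "C1_upper f fx fy" "C1_upper g gx gy"
  shows "C1_upper (\<lambda>z. f z * g z) (\<lambda>z. fx z * g z + f z * gx z) (\<lambda>z. fy z * g z + f z * gy z)"
  using assms unfolding C1_upper_def
  by (auto intro!: continuous_intros derivative_eq_intros simp: algebra_simps)

lemma C1_upper_divide:
  assumes "C1_upper f fx fy" "C1_upper g gx gy" and "\<And>z. z \<in> upper \<Longrightarrow> g z \<noteq> 0"
  shows "C1_upper (\<lambda>z. f z / g z)
    (\<lambda>z. (fx z * g z - f z * gx z) / (g z * g z)) (\<lambda>z. (fy z * g z - f z * gy z) / (g z * g z))"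
  using assms unfolding C1_upper_def
  by (auto intro!: continuous_intros DERIV_divide simp: upper_def)

lemmas C1_upper_intros = C1_upper_add C1_upper_diff C1_upper_mult

text \<open>Schwarz's theorem via the second difference \<open>D\<close> below: two mean value
  steps, taken in either order, show \<open>D / h^2\<close> to be a value of \<open>fxy\<close> and
  a value of \<open>fyx\<close> near the point. Of \<open>f\<close> only derivatives in the open
  half plane are asked for, which suits the pressure.\<close>

lemma symmetric_partial_derivatives:
  fixes f :: "real \<times> real \<Rightarrow> real"
  assumes fx: "\<And>x y. 0 < y \<Longrightarrow> ((\<lambda>s. f (s, y)) has_real_derivative fx (x, y)) (at x)"
    and fy: "\<And>x y. 0 < y \<Longrightarrow> ((\<lambda>t. f (x, t)) has_real_derivative fy (x, y)) (at y)"
    and fxy: "\<And>x y. 0 < y \<Longrightarrow> ((\<lambda>t. fx (x, t)) has_real_derivative fxy (x, y)) (at y)"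
    and fyx: "\<And>x y. 0 < y \<Longrightarrow> ((\<lambda>s. fy (s, y)) has_real_derivative fyx (x, y)) (at x)"
    and cxy: "continuous_on upper fxy" and cyx: "continuous_on upper fyx" and y: "0 < y"
  shows "fxy (x, y) = fyx (x, y)"
proof (rule ccontr)
  assume "fxy (x, y) \<noteq> fyx (x, y)"
  \<comment> \<open>With \<open>e\<close> half the gap, a value of \<open>fxy\<close> and a value of
    \<open>fyx\<close>, each closer than \<open>e\<close> to its value at the point, cannot
    coincide.\<close>
  define e where "e = \<bar>fxy (x, y) - fyx (x, y)\<bar> / 2"
  have e: "0 < e" using \<open>fxy (x, y) \<noteq> fyx (x, y)\<close> by (simp add: e_def)
  have up: "(x, y) \<in> upper" using y by (simp add: upper_def)
  obtain d1 where d1: "0 < d1" "\<And>w. w \<in> upper \<Longrightarrow> dist w (x, y) < d1 \<Longrightarrow> dist (fxy w) (fxy (x, y)) < e"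
    using cxy up e unfolding continuous_on_iff by metis
  obtain d2 where d2: "0 < d2" "\<And>w. w \<in> upper \<Longrightarrow> dist w (x, y) < d2 \<Longrightarrow> dist (fyx w) (fyx (x, y)) < e"
    using cyx up e unfolding continuous_on_iff by metis
  define h where "h = min d1 d2 / 3"
  have h: "0 < h" "2 * h < d1" "2 * h < d2" using d1(1) d2(1) by (auto simp: h_def)
  have close: "w \<in> upper \<and> dist w (x, y) < d1 \<and> dist w (x, y) < d2"
    if "w = (s, t)" "x < s" "s < x + h" "y < t" "t < y + h" for w s t
  proof -
    have "dist w (x, y) \<le> \<bar>s - x\<bar> + \<bar>t - y\<bar>"
      using that(1) by (simp add: dist_prod_def dist_real_def sqrt_sum_squares_le_sum_abs)
    also have "\<dots> < 2 * h" using that by simp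
    finally show ?thesis using that h y by (auto simp: upper_def)
  qed
  define D where "D = f (x + h, y + h) - f (x + h, y) - f (x, y + h) + f (x, y)"
  have "\<exists>s. x < s \<and> s < x + h \<and>
      (f (x + h, y + h) - f (x + h, y)) - (f (x, y + h) - f (x, y)) = (x + h - x) * (fx (s, y + h) - fx (s, y))"
    by (rule MVT2) (use h y in \<open>auto intro!: derivative_intros fx\<close>)
  then obtain s where s: "x < s" "s < x + h" "D = h * (fx (s, y + h) - fx (s, y))"
    by (auto simp: D_def)
  have "\<exists>t. y < t \<and> t < y + h \<and> fx (s, y + h) - fx (s, y) = (y + h - y) * fxy (s, t)"
    by (rule MVT2) (use h y in \<open>auto intro!: derivative_intros fxy\<close>)
  then obtain t where t: "y < t" "t < y + h" "D = h * h * fxy (s, t)"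
    using s(3) by auto
  have "\<exists>t. y < t \<and> t < y + h \<and>
      (f (x + h, y + h) - f (x, y + h)) - (f (x + h, y) - f (x, y)) = (y + h - y) * (fy (x + h, t) - fy (x, t))"
    by (rule MVT2) (use h y in \<open>auto intro!: derivative_intros fy\<close>)
  then obtain t' where t': "y < t'" "t' < y + h" "D = h * (fy (x + h, t') - fy (x, t'))"
    by (auto simp: D_def)
  have "\<exists>s. x < s \<and> s < x + h \<and> fy (x + h, t') - fy (x, t') = (x + h - x) * fyx (s, t')"
    by (rule MVT2) (use h y t' in \<open>auto intro!: derivative_intros fyx\<close>)
  then obtain s' where s': "x < s'" "s' < x + h" "D = h * h * fyx (s', t')"
    using t'(3) by auto
  have "fxy (s, t) = fyx (s', t')" using t(3) s'(3) h by simp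
  moreover have "\<bar>fxy (s, t) - fxy (x, y)\<bar> < e"
    using d1(2)[of "(s, t)"] close[of "(s, t)" s t] s t by (auto simp: dist_real_def)
  moreover have "\<bar>fyx (s', t') - fyx (x, y)\<bar> < e"
    using d2(2)[of "(s', t')"] close[of "(s', t')" s' t'] s' t' by (auto simp: dist_real_def)
  moreover have "2 * e = \<bar>fxy (x, y) - fyx (x, y)\<bar>" by (simp add: e_def)
  ultimately show False by linarith
qed

text \<open>Poincare's lemma with integration along vertical lines from the wall. The potential
  vanishes on the wall, hence the requirement that the tangential component \<open>g1\<close> vanish
  there.\<close>

lemma potential_upper:
  assumes g1: "C1_upper g1 g1x g1y" and g2: "C1_upper g2 g2x g2y"
    and curl: "\<And>z. z \<in> upper \<Longrightarrow> g1y z = g2x z"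
    and bd: "\<And>x. g1 (x, 0) = 0"
  shows "C1_upper (\<lambda>z. integral {0..snd z} (\<lambda>t. g2 (fst z, t))) g1 g2"
proof -
  note cg2 = C1_upperD(2)[OF g2]
  \<comment> \<open>Rescaling to the fixed interval from 0 to 1 makes continuity in both variables a
    statement about an integral with a parameter.\<close>
  have "continuous_on upper (\<lambda>z. integral (cbox 0 1) (\<lambda>t. g2 (fst z, snd z * t)))"
    by (rule integral_continuous_on_param)
       (auto simp: case_prod_beta upper_def intro!: continuous_on_compose2[OF C1_upperD(1)[OF g2]] continuous_intros)
  then have "continuous_on upper (\<lambda>z. snd z * integral {0..1} (\<lambda>t. g2 (fst z, snd z * t)))"
    by (auto intro!: continuous_intros)
  moreover have "snd z * integral {0..1} (\<lambda>t. g2 (fst z, snd z * t)) = integral {0..snd z} (\<lambda>t. g2 (fst z, t))"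
    if "z \<in> upper" for z
  proof (cases "snd z = 0")
    case False
    then have "(\<lambda>x. x / snd z) ` {0..snd z} = {0..1}"
      using that by (auto simp: upper_def image_iff field_simps intro!: bexI[of _ "_ * snd z"])
    then show ?thesis
      using integral_stretch_real[OF False, of 0 "snd z" "\<lambda>t. g2 (fst z, t)"] False that
      by (simp add: upper_def)
  qed auto
  ultimately have cont: "continuous_on upper (\<lambda>z. integral {0..snd z} (\<lambda>t. g2 (fst z, t)))"
    by (simp cong: continuous_on_cong)
  have dx: "((\<lambda>s. integral {0..y} (\<lambda>t. g2 (s, t))) has_real_derivative g1 (x, y)) (at x)" if y: "0 < y" for x y
  proof -
    have "((\<lambda>s. integral (cbox 0 y) (\<lambda>t. g2 (s, t))) has_field_derivative
        integral (cbox 0 y) (\<lambda>t. g2x (x, t))) (at x within UNIV)"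
    proof (rule leibniz_rule_field_derivative[where fx="\<lambda>s t. g2x (s, t)"])
      show "((\<lambda>s. g2 (s, t)) has_field_derivative g2x (s, t)) (at s within UNIV)" if "t \<in> cbox 0 y" for s t
        using C1_upperD(4)[OF g2] that by simp
      show "(\<lambda>t. g2 (s, t)) integrable_on cbox 0 y" for s
        by (intro integrable_continuous continuous_on_subset[OF continuous_on_slice_y[OF C1_upperD(1)[OF g2]]]) auto
      show "continuous_on (UNIV \<times> cbox 0 y) (\<lambda>(s, t). g2x (s, t))"
        unfolding case_prod_beta prod.collapse by (rule continuous_on_subset[OF cg2]) (auto simp: upper_def)
    qed auto
    \<comment> \<open>The curl condition turns the integrand left by the Leibniz rule into a
      \<open>y\<close>-derivative of \<open>g1\<close>, whose wall value is 0.\<close>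
    moreover have "((\<lambda>t. g2x (x, t)) has_integral g1 (x, y) - g1 (x, 0)) {0..y}"
    proof -
      have "((\<lambda>t. g1y (x, t)) has_integral g1 (x, y) - g1 (x, 0)) {0..y}"
        by (rule fundamental_theorem_of_calculus_interior)
           (use y C1_upperD(5)[OF g1] in \<open>auto simp flip: has_real_derivative_iff_has_vector_derivative
              intro: continuous_on_subset[OF continuous_on_slice_y[OF C1_upperD(1)[OF g1]]]\<close>)
      then show ?thesis
        by (rule has_integral_eq[rotated]) (use curl in \<open>auto simp: upper_def\<close>)
    qed
    ultimately show ?thesis
      using bd by (simp add: integral_unique)
  qed
  have dy: "((\<lambda>t. integral {0..t} (\<lambda>t. g2 (x, t))) has_real_derivative g2 (x, y)) (at y)" if y: "0 < y" for x y
  proof -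
    have "((\<lambda>t. integral {0..t} (\<lambda>t. g2 (x, t))) has_real_derivative g2 (x, y)) (at y within {0..y+1})"
      by (rule integral_has_real_derivative)
         (use y in \<open>auto intro: continuous_on_subset[OF continuous_on_slice_y[OF C1_upperD(1)[OF g2]]]\<close>)
    then show ?thesis
      using at_within_interior[of y "{0..y+1}"] y by (simp add: interior_atLeastAtMost_real)
  qed
  show ?thesis
    by (rule C1_upperI[OF cont C1_upperD(1)[OF g1] C1_upperD(1)[OF g2]]) (use dx dy in auto)
qed

section \<open>Boxes resting on the wall and the divergence theorem\<close>

definition hbox :: "real \<Rightarrow> (real \<times> real) set"
  where "hbox R = cbox (-R, 0) (R, R)"

lemma hbox_upper: "hbox R \<subseteq> upper"
  by (auto simp: hbox_def upper_def cbox_Pair_eq)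

lemma mem_hbox: "(x, y) \<in> hbox R \<longleftrightarrow> -R \<le> x \<and> x \<le> R \<and> 0 \<le> y \<and> y \<le> R"
  by (auto simp: hbox_def cbox_Pair_eq)

lemma hbox_mono: "r \<le> R \<Longrightarrow> hbox r \<subseteq> hbox R"
  by (auto simp: mem_hbox)

lemma integrable_hbox: "continuous_on upper f \<Longrightarrow> f integrable_on hbox R"
  for f :: "real \<times> real \<Rightarrow> real"
  unfolding hbox_def by (rule integrable_continuous) (use hbox_upper[of R] in \<open>auto simp: hbox_def intro: continuous_on_subset\<close>)

lemma content_hbox: "0 \<le> R \<Longrightarrow> measure lborel (hbox R) = 2 * R * R"
  unfolding hbox_def by (simp add: content_Pair)

text \<open>With its counterpart in the second variable, this is the divergence theorem for a field
  without flux through the sides of the box; all integration by parts rests on the two.\<close>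

lemma integral_partial_x_eq_0:
  assumes f: "C1_upper f fx fy" and R: "0 \<le> R"
    and bd: "\<And>y. 0 \<le> y \<Longrightarrow> f (-R, y) = 0" "\<And>y. 0 \<le> y \<Longrightarrow> f (R, y) = 0"
  shows "integral (hbox R) fx = 0"
proof -
  have c: "continuous_on (cbox (-R, 0) (R, R)) fx"
    using C1_upperD(2)[OF f] hbox_upper[of R] by (auto simp: hbox_def intro: continuous_on_subset)
  have "((\<lambda>x. fx (x, y)) has_integral f (R, y) - f (-R, y)) {-R..R}" if "0 \<le> y" for y
    by (rule fundamental_theorem_of_calculus)
       (use R C1_upperD(4)[OF f that] in
           \<open>auto simp flip: has_real_derivative_iff_has_vector_derivative intro: has_field_derivative_at_within\<close>)
  then have "integral {-R..R} (\<lambda>x. fx (x, y)) = 0" if "0 \<le> y" for y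
    using that bd[OF that] by (metis diff_self integral_unique)
  then have "integral {0..R} (\<lambda>y. integral {-R..R} (\<lambda>x. fx (x, y))) = integral {0..R} (\<lambda>_. 0)"
    by (intro integral_cong) simp
  then show ?thesis
    using integral_prod_continuous[OF c] integral_swap_continuous[of "-R" 0 R R "\<lambda>x y. fx (x, y)"] c
    by (simp add: hbox_def)
qed

lemma integral_partial_y_eq_0:
  assumes f: "C1_upper f fx fy" and R: "0 \<le> R"
    and bd: "\<And>x. f (x, 0) = 0" "\<And>x. f (x, R) = 0"
  shows "integral (hbox R) fy = 0"
proof -
  have c: "continuous_on (cbox (-R, 0) (R, R)) fy"
    using C1_upperD(3)[OF f] hbox_upper[of R] by (auto simp: hbox_def intro: continuous_on_subset)
  \<comment> \<open>The derivative is known only for \<open>y > 0\<close>; continuity on the closed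
    segment takes care of the endpoint on the wall.\<close>
  have "((\<lambda>y. fy (x, y)) has_integral f (x, R) - f (x, 0)) {0..R}" for x
    by (rule fundamental_theorem_of_calculus_interior)
       (use R C1_upperD(5)[OF f] in \<open>auto simp flip: has_real_derivative_iff_has_vector_derivative
          intro: continuous_on_subset[OF continuous_on_slice_y[OF C1_upperD(1)[OF f]]]\<close>)
  then have "integral {0..R} (\<lambda>y. fy (x, y)) = 0" for x
    using bd by (auto simp: integral_unique)
  then have "integral {-R..R} (\<lambda>x. integral {0..R} (\<lambda>y. fy (x, y))) = 0"
    by simp
  then show ?thesis
    using integral_prod_continuous[OF c] by (simp add: hbox_def)
qed

lemma C1_upper_cong:
  assumes "C1_upper f fx fy"
    and "\<And>z. z \<in> upper \<Longrightarrow> fx z = fx' z" "\<And>z. z \<in> upper \<Longrightarrow> fy z = fy' z"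
  shows "C1_upper f fx' fy'"
proof -
  have "continuous_on upper fx'" "continuous_on upper fy'"
    using C1_upperD(2,3)[OF assms(1)] assms(2,3) by (simp_all cong: continuous_on_cong)
  then show ?thesis
    using assms unfolding C1_upper_def by (auto simp: upper_def)
qed

lemma C1_upper_fst:
  assumes "\<And>t. (c has_real_derivative c' t) (at t)" "continuous_on UNIV c'"
  shows "C1_upper (\<lambda>z. c (fst z)) (\<lambda>z. c' (fst z)) (\<lambda>_. 0)"
proof -
  have "continuous_on UNIV c"
    using assms(1) by (meson DERIV_isCont continuous_at_imp_continuous_on)
  then show ?thesis
    using assms unfolding C1_upper_def by (auto intro!: continuous_intros elim: continuous_on_compose2)
qed

lemma C1_upper_snd:
  assumes "\<And>t. (c has_real_derivative c' t) (at t)" "continuous_on UNIV c'"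
  shows "C1_upper (\<lambda>z. c (snd z)) (\<lambda>_. 0) (\<lambda>z. c' (snd z))"
proof -
  have "continuous_on UNIV c"
    using assms(1) by (meson DERIV_isCont continuous_at_imp_continuous_on)
  then show ?thesis
    using assms unfolding C1_upper_def by (auto intro!: continuous_intros elim: continuous_on_compose2)
qed

subsection \<open>The cutoff\<close>

text \<open>
  The exponent 4 makes the first two derivatives of the cutoff at most a multiple of its square root.
\<close>

definition cutoff :: "real \<Rightarrow> real \<Rightarrow> real"
  where "cutoff R t = (1 - (t / R)\<^sup>2) ^ 4"

definition cutoff' :: "real \<Rightarrow> real \<Rightarrow> real"
  where "cutoff' R t = - 8 * t / R\<^sup>2 * (1 - (t / R)\<^sup>2) ^ 3"

definition cutoff'' :: "real \<Rightarrow> real \<Rightarrow> real"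
  where "cutoff'' R t = (56 * (t / R)\<^sup>2 - 8) / R\<^sup>2 * (1 - (t / R)\<^sup>2)\<^sup>2"

definition sqrt_cutoff :: "real \<Rightarrow> real \<Rightarrow> real"
  where "sqrt_cutoff R t = (1 - (t / R)\<^sup>2)\<^sup>2"

lemma cutoff_eq: "cutoff R t = (sqrt_cutoff R t)\<^sup>2"
  by (simp add: cutoff_def sqrt_cutoff_def flip: power_mult)

lemma DERIV_one_minus_square: "((\<lambda>t. 1 - (t / R)\<^sup>2) has_real_derivative - 2 * t / R\<^sup>2) (at t)"
proof -
  \<comment> \<open>Writing the quotient with \<open>inverse R\<close> covers \<open>R = 0\<close>
    as well, so the derivative rules for the cutoff need no hypothesis on \<open>R\<close>.\<close>
  have "((\<lambda>t. 1 - (t * inverse R)\<^sup>2) has_real_derivative - 2 * t * (inverse R * inverse R)) (at t)"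
    by (auto intro!: derivative_eq_intros simp: power2_eq_square)
  then show ?thesis by (simp add: divide_inverse power2_eq_square mult.assoc)
qed

lemma DERIV_cutoff: "(cutoff R has_real_derivative cutoff' R t) (at t)"
  unfolding cutoff_def[abs_def] cutoff'_def
  by (rule DERIV_cong[OF DERIV_power[OF DERIV_one_minus_square]]) simp

lemma DERIV_cutoff': "(cutoff' R has_real_derivative cutoff'' R t) (at t)"
proof -
  define i where "i = 1 / R\<^sup>2"
  define w where "w = 1 - (t / R)\<^sup>2"
  have w: "- 2 * t / R\<^sup>2 = - 2 * t * i" "(t / R)\<^sup>2 = t * t * i" "w = 1 - t * t * i"
    by (auto simp: i_def w_def power_divide power2_eq_square)
  have "((\<lambda>t. - 8 * t / R\<^sup>2) has_real_derivative - 8 * i) (at t)"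
    unfolding i_def by (intro DERIV_cong[OF DERIV_cdivide[OF DERIV_cmult[OF DERIV_ident]]]) simp
  from DERIV_mult[OF this DERIV_power[OF DERIV_one_minus_square[of R t], of 3]]
  have "(cutoff' R has_real_derivative
      - 8 * i * w ^ 3 + 3 * (- 2 * t * i * w\<^sup>2) * (- 8 * t * i)) (at t)"
    by (simp add: cutoff'_def[abs_def] w_def i_def)
  moreover have "- 8 * i * w ^ 3 + 3 * (- 2 * t * i * w\<^sup>2) * (- 8 * t * i) = (56 * (t * t * i) - 8) * i * w\<^sup>2"
    unfolding w(3) by algebra
  moreover have "\<dots> = cutoff'' R t"
    unfolding cutoff''_def w(2) w_def i_def by simp
  ultimately show ?thesis by simp
qed

lemma continuous_cutoff: "continuous_on UNIV (cutoff R)" "continuous_on UNIV (cutoff' R)"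
    "continuous_on UNIV (cutoff'' R)" "continuous_on UNIV (sqrt_cutoff R)"
  unfolding cutoff_def[abs_def] cutoff'_def[abs_def] cutoff''_def[abs_def] sqrt_cutoff_def[abs_def] divide_inverse
  by (auto intro!: continuous_intros)

text \<open>The cutoff is a polynomial and is not truncated, so the bounds are confined to
  \<open>\<bar>t\<bar> \<le> R\<close>. The generous constant 64 equals 8 * 8, so that products of
  two first derivatives obey the same bound as second derivatives.\<close>

lemma sqrt_cutoff_bounds:
  assumes "0 < R" "\<bar>t\<bar> \<le> R"
  shows "0 \<le> sqrt_cutoff R t" "sqrt_cutoff R t \<le> 1" "cutoff R t \<le> sqrt_cutoff R t" "0 \<le> cutoff R t"
    and "\<bar>cutoff' R t\<bar> \<le> 8 / R * sqrt_cutoff R t"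
    and "\<bar>cutoff'' R t\<bar> \<le> 64 / R\<^sup>2 * sqrt_cutoff R t"
proof -
  define s where "s = t / R"
  have s: "\<bar>s\<bar> \<le> 1" using assms by (simp add: s_def field_simps)
  then have s2: "0 \<le> s\<^sup>2" "s\<^sup>2 \<le> 1" by (auto simp: abs_square_le_1)
  define w where "w = 1 - s\<^sup>2"
  have w: "0 \<le> w" "w \<le> 1" using s2 by (auto simp: w_def)
  have "sqrt_cutoff R t = w\<^sup>2" by (simp add: sqrt_cutoff_def w_def s_def)
  then show 1: "0 \<le> sqrt_cutoff R t" "sqrt_cutoff R t \<le> 1" using w by (auto simp: power_le_one)
  show "cutoff R t \<le> sqrt_cutoff R t" "0 \<le> cutoff R t"
    unfolding cutoff_eq using 1 by (auto simp: power2_eq_square mult_left_le)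
  have "cutoff' R t = - (8 / R * (s * (w * w\<^sup>2)))"
    using assms by (simp add: cutoff'_def s_def w_def power2_eq_square power3_eq_cube)
  moreover have "\<bar>s * (w * w\<^sup>2)\<bar> \<le> w\<^sup>2"
  proof -
    have "\<bar>s\<bar> * (w * w\<^sup>2) \<le> 1 * (1 * w\<^sup>2)"
      using s w by (intro mult_mono) auto
    then show ?thesis using w by (simp add: abs_mult)
  qed
  ultimately show "\<bar>cutoff' R t\<bar> \<le> 8 / R * sqrt_cutoff R t"
    using assms \<open>sqrt_cutoff R t = w\<^sup>2\<close> by (simp add: abs_mult divide_right_mono)
  have "cutoff'' R t = (56 * s\<^sup>2 - 8) / R\<^sup>2 * sqrt_cutoff R t"
    by (simp add: cutoff''_def sqrt_cutoff_def s_def)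
  moreover have "\<bar>56 * s\<^sup>2 - 8\<bar> \<le> 64" using s2 by linarith
  then have "\<bar>56 * s\<^sup>2 - 8\<bar> / R\<^sup>2 * sqrt_cutoff R t \<le> 64 / R\<^sup>2 * sqrt_cutoff R t"
    using 1 by (intro mult_right_mono divide_right_mono) auto
  ultimately show "\<bar>cutoff'' R t\<bar> \<le> 64 / R\<^sup>2 * sqrt_cutoff R t"
    using 1 by (simp add: abs_mult)
qed

lemma sqrt_cutoff_antimono:
  assumes "0 < R" "0 \<le> s" "s \<le> t" "t \<le> R"
  shows "sqrt_cutoff R t \<le> sqrt_cutoff R s"
proof -
  have "(s / R)\<^sup>2 \<le> (t / R)\<^sup>2" "(t / R)\<^sup>2 \<le> 1"
    using assms by (auto simp: divide_right_mono power_mono power_le_one)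
  then show ?thesis unfolding sqrt_cutoff_def by (intro power_mono) auto
qed

lemma sqrt_cutoff_ge:
  assumes "0 < R" "\<bar>t\<bar> \<le> R / 2"
  shows "1 / 2 \<le> sqrt_cutoff R t"
proof -
  have "\<bar>t / R\<bar> \<le> 1 / 2" using assms by (simp add: field_simps)
  then have "(t / R)\<^sup>2 \<le> (1 / 2)\<^sup>2" by (rule power2_le_iff_abs_le[THEN iffD2, rotated]) simp
  then have "(3 / 4)\<^sup>2 \<le> sqrt_cutoff R t"
    unfolding sqrt_cutoff_def by (intro power_mono) (auto simp: power2_eq_square)
  then show ?thesis by (simp add: power2_eq_square)
qed

text \<open>Schwarz's theorem gives the identity in the open half plane, and continuity of both
  mixed derivatives carries it to the wall.\<close>

lemma C1_upper_symmetric: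
  assumes f: "C1_upper f fx fy" and fx: "C1_upper fx fxx fxy" and fy: "C1_upper fy fyx fyy"
    and z: "z \<in> upper"
  shows "fxy z = fyx z"
proof (rule eq_on_upper[OF C1_upperD(3)[OF fx] C1_upperD(2)[OF fy] _ z])
  fix z :: "real \<times> real" assume z: "0 < snd z"
  have "fxy (fst z, snd z) = fyx (fst z, snd z)"
    by (rule symmetric_partial_derivatives[of f fx fy])
       (auto intro: z C1_upperD[OF f] C1_upperD[OF fx] C1_upperD[OF fy])
  then show "fxy z = fyx z" by simp
qed

subsection \<open>The energy identity\<close>

text \<open>
  The velocity is \<open>(a, b)\<close>; an appended 1 or 2 denotes differentiation in the first or second variable.
\<close>

locale euler_half_plane =
  fixes a a1 a2 a11 a12 a21 a22 b b1 b2 b11 b12 b21 b22 p :: "real \<times> real \<Rightarrow> real" and m M :: real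
  assumes a: "C1_upper a a1 a2" and a1: "C1_upper a1 a11 a12" and a2: "C1_upper a2 a21 a22"
    and b: "C1_upper b b1 b2" and b1: "C1_upper b1 b11 b12" and b2: "C1_upper b2 b21 b22"
    and div0: "\<And>z. z \<in> upper \<Longrightarrow> b2 z = - a1 z"
    and p1: "\<And>x y. 0 < y \<Longrightarrow>
      ((\<lambda>s. p (s, y)) has_real_derivative - (a (x, y) * a1 (x, y) + b (x, y) * a2 (x, y))) (at x)"
    and p2: "\<And>x y. 0 < y \<Longrightarrow>
      ((\<lambda>t. p (x, t)) has_real_derivative - (a (x, y) * b1 (x, y) + b (x, y) * b2 (x, y))) (at y)"
    and wall: "\<And>x. b (x, 0) = 0"
    and m: "0 < m" and lower: "\<And>z. z \<in> upper \<Longrightarrow> m\<^sup>2 \<le> a z * a z + b z * b z"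
    and bounded: "\<And>z. z \<in> upper \<Longrightarrow> a z * a z + b z * b z \<le> M\<^sup>2"
begin

lemma a_symm: "z \<in> upper \<Longrightarrow> a12 z = a21 z"
  by (rule C1_upper_symmetric[OF a a1 a2])

lemma b_symm: "z \<in> upper \<Longrightarrow> b12 z = b21 z"
  by (rule C1_upper_symmetric[OF b b1 b2])

text \<open>
  \<open>(A1, A2)\<close> is the gradient of the argument of the velocity, \<open>phi\<close> the argument itself, and
  \<open>(B1, B2) = |v|\<^sup>2 \<nabla>phi\<close> is the pressure gradient rotated by a right angle.
\<close>

definition "q z = a z * a z + b z * b z"
definition "B1 z = a z * b1 z - b z * a1 z"
definition "B2 z = a z * b2 z - b z * a2 z"
definition "A1 z = B1 z / q z"
definition "A2 z = B2 z / q z"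
definition "B11 z = a1 z * b1 z + a z * b11 z - (b1 z * a1 z + b z * a11 z)"
definition "B12 z = a2 z * b1 z + a z * b12 z - (b2 z * a1 z + b z * a12 z)"
definition "B21 z = a1 z * b2 z + a z * b21 z - (b1 z * a2 z + b z * a21 z)"
definition "B22 z = a2 z * b2 z + a z * b22 z - (b2 z * a2 z + b z * a22 z)"
definition "q1 z = a1 z * a z + a z * a1 z + (b1 z * b z + b z * b1 z)"
definition "q2 z = a2 z * a z + a z * a2 z + (b2 z * b z + b z * b2 z)"
definition "phi z = integral {0..snd z} (\<lambda>t. A2 (fst z, t))"

lemma q: "C1_upper q q1 q2"
  unfolding q_def[abs_def] q1_def[abs_def] q2_def[abs_def] by (intro C1_upper_intros a b)

lemma B1: "C1_upper B1 B11 B12"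
  unfolding B1_def[abs_def] B11_def[abs_def] B12_def[abs_def] by (intro C1_upper_intros a b a1 b1)

lemma B2: "C1_upper B2 B21 B22"
  unfolding B2_def[abs_def] B21_def[abs_def] B22_def[abs_def] by (intro C1_upper_intros a b a2 b2)

lemma q_pos: "z \<in> upper \<Longrightarrow> 0 < q z"
  using lower[of z] m by (auto simp: q_def intro: less_le_trans[OF zero_less_power[OF m]])

text \<open>By incompressibility the pressure gradient is \<open>(B2, - B1)\<close>, so the claim is
  the symmetry of the mixed derivatives of \<open>p\<close>. These exist because \<open>B1\<close>
  and \<open>B2\<close> are differentiable, although nothing was assumed about second derivatives of
  \<open>p\<close>.\<close>

lemma B_div0:
  assumes "z \<in> upper"
  shows "B11 z + B22 z = 0"
proof -
  have "B22 z = - B11 z"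
  proof (rule eq_on_upper[OF _ _ _ assms])
    show "continuous_on upper B22" "continuous_on upper (\<lambda>z. - B11 z)"
      using C1_upperD[OF B1] C1_upperD[OF B2] by (auto intro: continuous_intros)
    fix z :: "real \<times> real" assume z: "0 < snd z"
    have d: "b2 (x, y) = - a1 (x, y)" if "0 < y" for x y
      using div0 that by (simp add: upper_def)
    have "B22 (fst z, snd z) = - B11 (fst z, snd z)"
    proof (rule symmetric_partial_derivatives[of p B2 "\<lambda>z. - B1 z" B22 "\<lambda>z. - B11 z"])
      show "((\<lambda>s. p (s, y)) has_real_derivative B2 (x, y)) (at x)" if "0 < y" for x y
        using p1[OF that, of x] d[OF that, of x] by (simp add: B2_def algebra_simps)
      show "((\<lambda>t. p (x, t)) has_real_derivative - B1 (x, y)) (at y)" if "0 < y" for x y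
        using p2[OF that, of x] d[OF that, of x] by (simp add: B1_def algebra_simps)
      show "((\<lambda>t. B2 (x, t)) has_real_derivative B22 (x, y)) (at y)" if "0 < y" for x y
        using C1_upperD(5)[OF B2 that] .
      show "((\<lambda>s. - B1 (s, y)) has_real_derivative - B11 (x, y)) (at x)" if "0 < y" for x y
        by (intro DERIV_minus C1_upperD(4)[OF B1]) (use that in simp)
    qed (use z C1_upperD[OF B1] C1_upperD[OF B2] in \<open>auto intro: continuous_intros\<close>)
    then show "B22 z = - B11 z" by simp
  qed
  then show ?thesis by simp
qed

lemma A1: "C1_upper A1 (\<lambda>z. (B11 z * q z - B1 z * q1 z) / (q z * q z)) (\<lambda>z. (B12 z * q z - B1 z * q2 z) / (q z * q z))"
  unfolding A1_def[abs_def] by (rule C1_upper_divide[OF B1 q]) (use q_pos in force)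

lemma A2: "C1_upper A2 (\<lambda>z. (B21 z * q z - B2 z * q1 z) / (q z * q z)) (\<lambda>z. (B22 z * q z - B2 z * q2 z) / (q z * q z))"
  unfolding A2_def[abs_def] by (rule C1_upper_divide[OF B2 q]) (use q_pos in force)

text \<open>Away from zeros of the velocity the gradient of its argument is curl free, an algebraic
  identity once mixed derivatives commute. Its tangential component vanishes on the wall because
  \<open>b\<close> does, so the potential can be based there.\<close>

lemma phi: "C1_upper phi A1 A2"
  unfolding phi_def[abs_def]
proof (rule potential_upper[OF A1 A2])
  fix z assume z: "z \<in> upper"
  have "B12 z * q z - B1 z * q2 z = B21 z * q z - B2 z * q1 z"
    unfolding B12_def B21_def B1_def B2_def q_def q1_def q2_def a_symm[OF z] b_symm[OF z]
    by algebra
  then show "(B12 z * q z - B1 z * q2 z) / (q z * q z) = (B21 z * q z - B2 z * q1 z) / (q z * q z)"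
    by simp
next
  fix x
  have "((\<lambda>s. b (s, 0)) has_real_derivative b1 (x, 0)) (at x)"
    by (rule C1_upperD(4)[OF b]) simp
  then have "b1 (x, 0) = 0"
    using DERIV_unique[of "\<lambda>s. b (s, 0)" "b1 (x, 0)" x 0] by (simp add: wall)
  then show "A1 (x, 0) = 0" by (simp add: A1_def B1_def wall)
qed

lemma phi_wall: "phi (x, 0) = 0"
  by (simp add: phi_def)

text \<open>Since \<open>phi\<close> vanishes on the wall, it is bounded by the integral of its
  vertical derivative. The weight decreases away from the wall, so its value at \<open>y\<close> can
  be pulled inside and replaced by its larger value at \<open>t\<close>.\<close>

lemma abs_phi_le:
  assumes "0 < R" "0 \<le> y" "y \<le> R"
  shows "sqrt_cutoff R y * \<bar>phi (x, y)\<bar> \<le> integral {0..R} (\<lambda>t. sqrt_cutoff R t * \<bar>A2 (x, t)\<bar>)"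
proof -
  have c: "continuous_on {0..r} (\<lambda>t. A2 (x, t))" for r
    using continuous_on_slice_y[OF C1_upperD(1)[OF A2]] by (rule continuous_on_subset) auto
  have k: "continuous_on S (sqrt_cutoff R)" for S
    using continuous_cutoff(4) by (rule continuous_on_subset) auto
  have i: "(\<lambda>t. sqrt_cutoff R t * \<bar>A2 (x, t)\<bar>) integrable_on {0..r}" for r
    by (intro integrable_continuous_real continuous_intros k c)
  have "\<bar>phi (x, y)\<bar> \<le> integral {0..y} (\<lambda>t. \<bar>A2 (x, t)\<bar>)"
    unfolding phi_def fst_conv snd_conv
    unfolding real_norm_def[symmetric]
    by (rule integral_norm_bound_integral) (auto intro!: integrable_continuous_real continuous_intros c)
  then have "sqrt_cutoff R y * \<bar>phi (x, y)\<bar> \<le> sqrt_cutoff R y * integral {0..y} (\<lambda>t. \<bar>A2 (x, t)\<bar>)"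
    using assms sqrt_cutoff_bounds(1)[of R y] by (intro mult_left_mono) auto
  also have "\<dots> = integral {0..y} (\<lambda>t. sqrt_cutoff R y * \<bar>A2 (x, t)\<bar>)"
    by simp
  also have "\<dots> \<le> integral {0..y} (\<lambda>t. sqrt_cutoff R t * \<bar>A2 (x, t)\<bar>)"
    by (intro integral_le i integrable_continuous_real continuous_intros c mult_right_mono sqrt_cutoff_antimono)
       (use assms in auto)
  also have "\<dots> \<le> integral {0..R} (\<lambda>t. sqrt_cutoff R t * \<bar>A2 (x, t)\<bar>)"
    by (intro integral_subset_le i) (use assms sqrt_cutoff_bounds(1)[of R] in auto)
  finally show ?thesis .
qed

definition "eta R z = cutoff R (fst z) * cutoff R (snd z)"
definition "eta1 R z = cutoff' R (fst z) * cutoff R (snd z)"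
definition "eta2 R z = cutoff R (fst z) * cutoff' R (snd z)"
definition "eta11 R z = cutoff'' R (fst z) * cutoff R (snd z)"
definition "eta12 R z = cutoff' R (fst z) * cutoff' R (snd z)"
definition "eta22 R z = cutoff R (fst z) * cutoff'' R (snd z)"

lemma eta: "C1_upper (eta R) (eta1 R) (eta2 R)"
  unfolding eta_def[abs_def] eta1_def[abs_def] eta2_def[abs_def]
  by (rule C1_upper_cong[OF C1_upper_mult[OF C1_upper_fst[OF DERIV_cutoff continuous_cutoff(2)]
        C1_upper_snd[OF DERIV_cutoff continuous_cutoff(2)]]]) simp_all

lemma eta1: "C1_upper (eta1 R) (eta11 R) (eta12 R)"
  unfolding eta1_def[abs_def] eta11_def[abs_def] eta12_def[abs_def]
  by (rule C1_upper_cong[OF C1_upper_mult[OF C1_upper_fst[OF DERIV_cutoff' continuous_cutoff(3)]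
        C1_upper_snd[OF DERIV_cutoff continuous_cutoff(2)]]]) simp_all

lemma eta2: "C1_upper (eta2 R) (eta12 R) (eta22 R)"
  unfolding eta2_def[abs_def] eta12_def[abs_def] eta22_def[abs_def]
  by (rule C1_upper_cong[OF C1_upper_mult[OF C1_upper_fst[OF DERIV_cutoff continuous_cutoff(2)]
        C1_upper_snd[OF DERIV_cutoff' continuous_cutoff(3)]]]) simp_all

text \<open>
  What remains of \<open>\<integral> eta |v|\<^sup>2 |\<nabla>phi|\<^sup>2\<close> after integrating by parts once with \<open>(B1, B2)\<close> divergence free
  and once with \<open>B1 = (ab)\<^sub>1 + (b\<^sup>2)\<^sub>2\<close>, \<open>B2 = - (a\<^sup>2)\<^sub>1 - (ab)\<^sub>2\<close> (the momentum equation in divergence form).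
\<close>

definition "T R z = A1 z * eta1 R z * a z * b z + A2 z * eta1 R z * b z * b z
  - A1 z * eta2 R z * a z * a z - A2 z * eta2 R z * a z * b z
  + phi z * (a z * b z * (eta11 R z - eta22 R z) + eta12 R z * (b z * b z - a z * a z))"

lemma continuous_T: "continuous_on upper (T R)"
  unfolding T_def[abs_def]
  by (intro continuous_intros C1_upperD(1,2,3)[OF A1] C1_upperD(1)[OF A2] C1_upperD(1)[OF a] C1_upperD(1)[OF b]
      C1_upperD(1)[OF phi] C1_upperD(1,2,3)[OF eta1] C1_upperD(1,2,3)[OF eta2])

text \<open>The difference of the two integrands is the divergence of the field whose components are
  differentiated in \<open>F1\<close> and \<open>F2\<close>.\<close>

lemma energy_identity:
  assumes R: "0 < R"
  shows "integral (hbox R) (\<lambda>z. eta R z * (A1 z * B1 z + A2 z * B2 z)) = integral (hbox R) (T R)"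
proof -
  note F1 = C1_upper_add[OF C1_upper_diff[OF C1_upper_mult[OF phi C1_upper_mult[OF eta[of R] B1]]
        C1_upper_mult[OF phi C1_upper_mult[OF eta1[of R] C1_upper_mult[OF a b]]]]
        C1_upper_mult[OF phi C1_upper_mult[OF eta2[of R] C1_upper_mult[OF a a]]]]
  note F2 = C1_upper_add[OF C1_upper_diff[OF C1_upper_mult[OF phi C1_upper_mult[OF eta[of R] B2]]
        C1_upper_mult[OF phi C1_upper_mult[OF eta1[of R] C1_upper_mult[OF b b]]]]
        C1_upper_mult[OF phi C1_upper_mult[OF eta2[of R] C1_upper_mult[OF a b]]]]
  have cR: "cutoff R R = 0" "cutoff R (-R) = 0" "cutoff' R R = 0" "cutoff' R (-R) = 0"
    using R by (auto simp: cutoff_def cutoff'_def)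
  note I1 = integral_partial_x_eq_0[OF F1 less_imp_le[OF R]]
  note I2 = integral_partial_y_eq_0[OF F2 less_imp_le[OF R]]
  have "integral (hbox R) (\<lambda>z. eta R z * (A1 z * B1 z + A2 z * B2 z) - T R z) =
      integral (hbox R) (\<lambda>z. (A1 z * (eta R z * B1 z) + phi z * (eta1 R z * B1 z + eta R z * B11 z)
        - (A1 z * (eta1 R z * (a z * b z)) + phi z * (eta11 R z * (a z * b z) + eta1 R z * (a1 z * b z + a z * b1 z)))
        + (A1 z * (eta2 R z * (a z * a z)) + phi z * (eta12 R z * (a z * a z) + eta2 R z * (a1 z * a z + a z * a1 z))))
      + (A2 z * (eta R z * B2 z) + phi z * (eta2 R z * B2 z + eta R z * B22 z)
        - (A2 z * (eta1 R z * (b z * b z)) + phi z * (eta12 R z * (b z * b z) + eta1 R z * (b2 z * b z + b z * b2 z)))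
        + (A2 z * (eta2 R z * (a z * b z)) + phi z * (eta22 R z * (a z * b z) + eta2 R z * (a2 z * b z + a z * b2 z)))))"
  proof (rule integral_cong, goal_cases)
    case (1 z)
    then have z: "z \<in> upper" using hbox_upper by blast
    show ?case
      using B_div0[OF z] div0[OF z] unfolding T_def B1_def[of z] B2_def[of z] by algebra
  qed
  \<comment> \<open>On the sides \<open>x = R\<close>, \<open>x = -R\<close> and
    \<open>y = R\<close> every term carries a vanishing factor \<open>cutoff\<close> or
    \<open>cutoff'\<close>. On the wall the cutoff is not small; there \<open>phi\<close>
    vanishes.\<close>
  also have "\<dots> = 0 + 0"
    by (subst integral_add)
       (use I1 I2 C1_upperD(2)[OF F1] C1_upperD(3)[OF F2] in
         \<open>auto intro!: integrable_hbox simp: eta_def eta1_def eta2_def cR phi_wall\<close>)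
  finally show ?thesis
    by (subst (asm) integral_diff)
       (auto intro!: integrable_hbox continuous_T continuous_intros C1_upperD(1)[OF A1] C1_upperD(1)[OF A2]
         C1_upperD(1)[OF B1] C1_upperD(1)[OF B2] C1_upperD(1)[OF eta])
qed

subsection \<open>Vanishing of the energy\<close>

text \<open>\<open>X\<close> and \<open>N\<close> are the squared Euclidean norm and the 1-norm of
  the gradient of \<open>phi\<close>; \<open>K\<close> is the square root of \<open>eta\<close>, the
  weight left after differentiating \<open>eta\<close>.\<close>

definition "X z = (A1 z)\<^sup>2 + (A2 z)\<^sup>2"
definition "N z = \<bar>A1 z\<bar> + \<bar>A2 z\<bar>"
definition "K R z = sqrt_cutoff R (fst z) * sqrt_cutoff R (snd z)"

lemma continuous_K: "continuous_on S (K R)"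
  unfolding K_def[abs_def] by (intro continuous_intros continuous_on_compose2[OF continuous_cutoff(4)]) auto

lemma continuous_N: "continuous_on upper N"
  unfolding N_def[abs_def] by (intro continuous_intros C1_upperD(1)[OF A1] C1_upperD(1)[OF A2])

lemma continuous_X: "continuous_on upper X"
  unfolding X_def[abs_def] by (intro continuous_intros C1_upperD(1)[OF A1] C1_upperD(1)[OF A2])

lemma continuous_eta: "continuous_on upper (eta R)"
  by (rule C1_upperD(1)[OF eta])

lemma continuous_KN: "continuous_on upper (\<lambda>z. K R z * N z)"
  by (intro continuous_intros continuous_K continuous_N)

lemma eta_eq: "eta R z = (K R z)\<^sup>2"
  by (simp add: eta_def K_def cutoff_eq power_mult_distrib)

lemma K_bounds:
  assumes "0 < R" "z \<in> hbox R"
  shows "0 \<le> K R z" "K R z \<le> 1"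
proof -
  have "\<bar>fst z\<bar> \<le> R" "\<bar>snd z\<bar> \<le> R" using assms by (cases z, auto simp: mem_hbox)+
  then show "0 \<le> K R z" "K R z \<le> 1"
    using sqrt_cutoff_bounds[OF assms(1)] by (auto simp: K_def intro!: mult_le_one)
qed

lemma eta_derivative_bounds:
  assumes R: "0 < R" and z: "z \<in> hbox R"
  shows "\<bar>eta1 R z\<bar> \<le> 8 / R * K R z" "\<bar>eta2 R z\<bar> \<le> 8 / R * K R z"
    "\<bar>eta11 R z\<bar> \<le> 64 / R\<^sup>2 * K R z" "\<bar>eta12 R z\<bar> \<le> 64 / R\<^sup>2 * K R z" "\<bar>eta22 R z\<bar> \<le> 64 / R\<^sup>2 * K R z"
proof -
  have "\<bar>fst z\<bar> \<le> R" "\<bar>snd z\<bar> \<le> R" using z by (cases z, auto simp: mem_hbox)+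
  note x = sqrt_cutoff_bounds[OF R this(1)] and y = sqrt_cutoff_bounds[OF R this(2)]
  have *: "\<bar>f * g\<bar> \<le> c * (s * t)" if "\<bar>f\<bar> \<le> k * s" "\<bar>g\<bar> \<le> l * t" "c = k * l" "0 \<le> k" "0 \<le> s"
    for f g c k l s t :: real
    using mult_mono[OF that(1,2)] that(3-5) by (simp add: abs_mult mult_ac)
  show "\<bar>eta1 R z\<bar> \<le> 8 / R * K R z"
    unfolding eta1_def K_def by (rule *[where k="8/R" and l=1]) (use R x y in auto)
  show "\<bar>eta2 R z\<bar> \<le> 8 / R * K R z"
    unfolding eta2_def K_def by (rule *[where l="8/R" and k=1]) (use R x y in auto)
  show "\<bar>eta11 R z\<bar> \<le> 64 / R\<^sup>2 * K R z"
    unfolding eta11_def K_def by (rule *[where k="64/R\<^sup>2" and l=1]) (use R x y in auto)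
  show "\<bar>eta22 R z\<bar> \<le> 64 / R\<^sup>2 * K R z"
    unfolding eta22_def K_def by (rule *[where l="64/R\<^sup>2" and k=1]) (use R x y in auto)
  show "\<bar>eta12 R z\<bar> \<le> 64 / R\<^sup>2 * K R z"
    unfolding eta12_def K_def
    by (rule *[where k="8/R" and l="8/R"]) (use R x y in \<open>auto simp: power2_eq_square\<close>)
qed

text \<open>First derivatives of \<open>eta\<close> cost a factor \<open>8 / R\<close>, second ones
  \<open>64 / R^2\<close>, and every quadratic expression in the velocity is at most
  \<open>M^2\<close>. Each component of the gradient occurs twice, giving 16 = 8 + 8; the terms with
  \<open>phi\<close> give 192 = 2 * 64 + 64.\<close>

lemma T_le:
  assumes R: "0 < R" and z: "z \<in> hbox R"
  shows "T R z \<le> 16 * M\<^sup>2 / R * (K R z * N z) + 192 * M\<^sup>2 / R\<^sup>2 * (K R z * \<bar>phi z\<bar>)"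
proof -
  note e = eta_derivative_bounds[OF R z]
  have up: "a z * a z + b z * b z \<le> M\<^sup>2" using bounded z hbox_upper by blast
  have sq: "0 \<le> a z * a z" "0 \<le> b z * b z" by auto
  have pm: "2 * (a z * b z) \<le> a z * a z + b z * b z" "- (2 * (a z * b z)) \<le> a z * a z + b z * b z"
    using zero_le_power2[of "a z - b z"] zero_le_power2[of "a z + b z"] by (auto simp: power2_eq_square algebra_simps)
  have ab: "\<bar>a z * b z\<bar> \<le> M\<^sup>2" "\<bar>a z * a z\<bar> \<le> M\<^sup>2" "\<bar>b z * b z\<bar> \<le> M\<^sup>2" "\<bar>b z * b z - a z * a z\<bar> \<le> M\<^sup>2"
    using up sq pm by linarith+
  have *: "\<bar>u * f * w\<bar> \<le> c * k * W * \<bar>u\<bar>" if "\<bar>f\<bar> \<le> c * k" "\<bar>w\<bar> \<le> W" for u f w c k W :: real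
  proof -
    have "\<bar>f\<bar> * \<bar>w\<bar> \<le> (c * k) * W" using that by (intro mult_mono) auto
    then show ?thesis using mult_left_mono[of "\<bar>f\<bar> * \<bar>w\<bar>" "(c * k) * W" "\<bar>u\<bar>"] by (simp add: abs_mult mult_ac)
  qed
  have sum_le: "t1 + t2 - t3 - t4 + t5 + t6 \<le> u1 + u2 + u3 + u4 + u5 + u6"
    if "\<bar>t1\<bar> \<le> u1" "\<bar>t2\<bar> \<le> u2" "\<bar>t3\<bar> \<le> u3" "\<bar>t4\<bar> \<le> u4" "\<bar>t5\<bar> \<le> u5" "\<bar>t6\<bar> \<le> u6"
    for t1 t2 t3 t4 t5 t6 u1 u2 u3 u4 u5 u6 :: real
    using that by linarith
  have d: "\<bar>eta11 R z - eta22 R z\<bar> \<le> 128 / R\<^sup>2 * K R z" using e(3,5) by (simp add: abs_le_iff)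
  have "T R z = A1 z * eta1 R z * (a z * b z) + A2 z * eta1 R z * (b z * b z)
      - A1 z * eta2 R z * (a z * a z) - A2 z * eta2 R z * (a z * b z)
      + phi z * (eta11 R z - eta22 R z) * (a z * b z) + phi z * eta12 R z * (b z * b z - a z * a z)"
    unfolding T_def by (simp add: algebra_simps)
  also have "\<dots> \<le> 8 / R * K R z * M\<^sup>2 * \<bar>A1 z\<bar> + 8 / R * K R z * M\<^sup>2 * \<bar>A2 z\<bar>
      + 8 / R * K R z * M\<^sup>2 * \<bar>A1 z\<bar> + 8 / R * K R z * M\<^sup>2 * \<bar>A2 z\<bar>
      + 128 / R\<^sup>2 * K R z * M\<^sup>2 * \<bar>phi z\<bar> + 64 / R\<^sup>2 * K R z * M\<^sup>2 * \<bar>phi z\<bar>"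
    by (rule sum_le[OF *[OF e(1) ab(1)] *[OF e(1) ab(3)] *[OF e(2) ab(2)] *[OF e(2) ab(1)]
        *[OF d ab(1)] *[OF e(4) ab(4)]])
  also have "\<dots> = 16 * M\<^sup>2 / R * (K R z * N z) + 192 * M\<^sup>2 / R\<^sup>2 * (K R z * \<bar>phi z\<bar>)"
    using R by (simp add: N_def field_simps)
  finally show ?thesis .
qed

text \<open>The right-hand side no longer depends on \<open>y\<close>; integrating it over the box
  therefore gains only a factor \<open>R\<close>.\<close>

lemma K_phi_le:
  assumes R: "0 < R" and z: "(x, y) \<in> hbox R"
  shows "K R (x, y) * \<bar>phi (x, y)\<bar> \<le> integral {0..R} (\<lambda>t. K R (x, t) * N (x, t))"
proof -
  have x: "0 \<le> sqrt_cutoff R x" using z sqrt_cutoff_bounds(1)[OF R] by (auto simp: mem_hbox)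
  have k: "continuous_on S (sqrt_cutoff R)" for S
    using continuous_cutoff(4) by (rule continuous_on_subset) auto
  have c: "continuous_on {0..R} (\<lambda>t. A2 (x, t))" "continuous_on {0..R} (\<lambda>t. A1 (x, t))"
    by (auto intro: continuous_on_subset[OF continuous_on_slice_y[OF C1_upperD(1)[OF A2]]]
        continuous_on_subset[OF continuous_on_slice_y[OF C1_upperD(1)[OF A1]]])
  have "K R (x, y) * \<bar>phi (x, y)\<bar> = sqrt_cutoff R x * (sqrt_cutoff R y * \<bar>phi (x, y)\<bar>)"
    by (simp add: K_def)
  also have "\<dots> \<le> sqrt_cutoff R x * integral {0..R} (\<lambda>t. sqrt_cutoff R t * \<bar>A2 (x, t)\<bar>)"
    using abs_phi_le[OF R] z x by (intro mult_left_mono) (auto simp: mem_hbox)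
  also have "\<dots> = integral {0..R} (\<lambda>t. sqrt_cutoff R x * (sqrt_cutoff R t * \<bar>A2 (x, t)\<bar>))"
    by simp
  also have "\<dots> \<le> integral {0..R} (\<lambda>t. K R (x, t) * N (x, t))"
    unfolding K_def N_def
    by (intro integral_le integrable_continuous_real continuous_intros k c)
       (use x sqrt_cutoff_bounds(1)[OF R] k in \<open>auto simp: mult.assoc intro!: mult_left_mono\<close>)
  finally show ?thesis .
qed

definition "E R = integral (hbox R) (\<lambda>z. eta R z * X z)"
definition "G R = integral (hbox R) X"
text \<open>Here 208 = 16 + 192 collects both constants of \<open>T_le\<close>; the division by
  \<open>m^2\<close> comes from the lower bound on the speed.\<close>

definition "C = 208 * M\<^sup>2 / m\<^sup>2"

lemma E_le:
  assumes R: "0 < R"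
  shows "E R \<le> C / R * integral (hbox R) (\<lambda>z. K R z * N z)"
proof -
  define S where "S x = integral {0..R} (\<lambda>t. K R (x, t) * N (x, t))" for x
  have cKN: "continuous_on (UNIV \<times> cbox 0 R) (\<lambda>(x, t). K R (x, t) * N (x, t))"
    unfolding case_prod_beta prod.collapse
    by (rule continuous_on_subset[OF continuous_KN]) (auto simp: upper_def)
  have "continuous_on UNIV (\<lambda>x. integral (cbox 0 R) (\<lambda>t. K R (x, t) * N (x, t)))"
    by (rule integral_continuous_on_param[OF cKN])
  then have cS: "continuous_on UNIV S" by (simp add: S_def[abs_def])
  then have cS': "continuous_on A (\<lambda>z. S (fst z))" for A :: "(real \<times> real) set"
    by (rule continuous_on_compose2) (auto intro: continuous_intros)
  have cKN': "continuous_on (cbox (-R, 0) (R, R)) (\<lambda>z. K R z * N z)"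
    using continuous_KN by (rule continuous_on_subset) (use hbox_upper[of R] in \<open>simp add: hbox_def\<close>)
  \<comment> \<open>The factor \<open>R\<close> gained here lowers the coefficient
    \<open>192 * M^2 / R^2\<close> of the \<open>phi\<close> terms to order \<open>1 / R\<close>,
    the order of the other terms.\<close>
  have intS: "integral (hbox R) (\<lambda>z. S (fst z)) = R * integral (hbox R) (\<lambda>z. K R z * N z)"
    unfolding hbox_def integral_prod_continuous[OF cS'] integral_prod_continuous[OF cKN']
    using R by (simp add: S_def)
  have "m\<^sup>2 * E R = integral (hbox R) (\<lambda>z. m\<^sup>2 * (eta R z * X z))"
    by (simp add: E_def)
  also have "\<dots> \<le> integral (hbox R) (\<lambda>z. eta R z * (A1 z * B1 z + A2 z * B2 z))"
  proof (rule integral_le)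
    fix z assume "z \<in> hbox R"
    then have z: "z \<in> upper" using hbox_upper by blast
    \<comment> \<open>As \<open>B\<close> is \<open>q\<close> times the gradient \<open>A\<close>,
      the tested quantity is the energy density weighted by the squared speed.\<close>
    have "A1 z * B1 z + A2 z * B2 z = q z * X z"
      using q_pos[OF z] by (simp add: A1_def A2_def X_def field_simps power2_eq_square)
    moreover have "m\<^sup>2 * X z \<le> q z * X z"
      using lower[OF z] by (intro mult_right_mono) (auto simp: q_def X_def)
    ultimately have "eta R z * (m\<^sup>2 * X z) \<le> eta R z * (A1 z * B1 z + A2 z * B2 z)"
      by (intro mult_left_mono) (auto simp: eta_eq)
    then show "m\<^sup>2 * (eta R z * X z) \<le> eta R z * (A1 z * B1 z + A2 z * B2 z)"
      by (simp add: mult_ac)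
  qed (intro integrable_hbox continuous_intros continuous_eta continuous_X C1_upperD(1)[OF A1] C1_upperD(1)[OF A2]
         C1_upperD(1)[OF B1] C1_upperD(1)[OF B2])+
  also have "\<dots> = integral (hbox R) (T R)"
    by (rule energy_identity[OF R])
  also have "\<dots> \<le> integral (hbox R) (\<lambda>z. 16 * M\<^sup>2 / R * (K R z * N z) + 192 * M\<^sup>2 / R\<^sup>2 * S (fst z))"
  proof (rule integral_le)
    fix z assume z: "z \<in> hbox R"
    have "192 * M\<^sup>2 / R\<^sup>2 * (K R z * \<bar>phi z\<bar>) \<le> 192 * M\<^sup>2 / R\<^sup>2 * S (fst z)"
      using K_phi_le[OF R, of "fst z" "snd z"] z by (intro mult_left_mono) (auto simp: S_def)
    then show "T R z \<le> 16 * M\<^sup>2 / R * (K R z * N z) + 192 * M\<^sup>2 / R\<^sup>2 * S (fst z)"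
      using T_le[OF R z] by linarith
  qed (intro integrable_hbox continuous_intros continuous_T continuous_KN cS')+
  also have "\<dots> = integral (hbox R) (\<lambda>z. 16 * M\<^sup>2 / R * (K R z * N z)) + integral (hbox R) (\<lambda>z. 192 * M\<^sup>2 / R\<^sup>2 * S (fst z))"
    by (intro integral_add integrable_hbox continuous_intros continuous_KN cS')
  also have "\<dots> = 16 * M\<^sup>2 / R * integral (hbox R) (\<lambda>z. K R z * N z) + 192 * M\<^sup>2 / R\<^sup>2 * (R * integral (hbox R) (\<lambda>z. K R z * N z))"
    by (simp only: integral_mult_right intS)
  also have "\<dots> = m\<^sup>2 * (C / R * integral (hbox R) (\<lambda>z. K R z * N z))"
    using R m by (simp add: C_def field_simps power2_eq_square)
  finally show ?thesis
    using m by (simp only: mult_le_cancel_left_pos zero_less_power)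
qed

lemma N_square_le: "(N z)\<^sup>2 \<le> 2 * X z"
  using sum_squares_bound[of "\<bar>A1 z\<bar>" "\<bar>A2 z\<bar>"] by (simp add: N_def X_def power2_sum)

text \<open>Young's inequality absorbs half of the energy on the left. The remainder
  \<open>C^2 / R^2\<close>, integrated over a box of area \<open>2 * R^2\<close>, stays bounded:
  this is where dimension two enters.\<close>

lemma E_bounded:
  assumes R: "0 < R"
  shows "E R \<le> 4 * C\<^sup>2"
proof -
  have "E R \<le> integral (hbox R) (\<lambda>z. C / R * (K R z * N z))"
    using E_le[OF R] by simp
  also have "\<dots> \<le> integral (hbox R) (\<lambda>z. 1 / 2 * (eta R z * X z) + C\<^sup>2 / R\<^sup>2)"
  proof (rule integral_le)
    fix z
    have "0 \<le> (K R z * N z / 2 - C / R)\<^sup>2" by simp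
    also have "\<dots> = (K R z)\<^sup>2 * (N z)\<^sup>2 / 4 + C\<^sup>2 / R\<^sup>2 - C / R * (K R z * N z)"
      by (simp add: power2_diff power_mult_distrib power_divide)
    finally show "C / R * (K R z * N z) \<le> 1 / 2 * (eta R z * X z) + C\<^sup>2 / R\<^sup>2"
      using mult_left_mono[OF N_square_le[of z], of "(K R z)\<^sup>2"] by (simp add: eta_eq)
  qed (intro integrable_hbox continuous_intros continuous_eta continuous_X continuous_KN)+
  also have "\<dots> = integral (hbox R) (\<lambda>z. 1 / 2 * (eta R z * X z)) + integral (hbox R) (\<lambda>z. C\<^sup>2 / R\<^sup>2)"
    by (intro integral_add integrable_hbox continuous_intros continuous_eta continuous_X)
  also have "\<dots> = E R / 2 + 2 * C\<^sup>2"
    using R content_hbox[of R] by (simp add: E_def hbox_def power2_eq_square)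
  finally show ?thesis by simp
qed

lemma X_nonneg: "0 \<le> X z"
  by (simp add: X_def)

lemma G_mono: "r \<le> R \<Longrightarrow> G r \<le> G R"
  unfolding G_def by (intro integral_subset_le hbox_mono integrable_hbox continuous_X) (auto simp: X_nonneg)

text \<open>On the inner box each one-dimensional factor of \<open>K\<close> is at least 1/2, hence
  \<open>K\<close> at least 1/4 and \<open>eta\<close> at least 1/16.\<close>

lemma G_le_E:
  assumes R: "0 < R"
  shows "G R \<le> 16 * E (2 * R)"
proof -
  have "G R \<le> integral (hbox R) (\<lambda>z. 16 * (eta (2 * R) z * X z))"
    unfolding G_def
  proof (rule integral_le)
    fix z assume "z \<in> hbox R"
    then have "\<bar>fst z\<bar> \<le> 2 * R / 2" "\<bar>snd z\<bar> \<le> 2 * R / 2"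
      by (cases z, auto simp: mem_hbox)+
    then have "1 / 2 \<le> sqrt_cutoff (2 * R) (fst z)" "1 / 2 \<le> sqrt_cutoff (2 * R) (snd z)"
      using R sqrt_cutoff_ge[of "2 * R"] by auto
    then have "1 / 2 * (1 / 2) \<le> K (2 * R) z"
      unfolding K_def by (intro mult_mono) auto
    then have "(1 / 4)\<^sup>2 \<le> (K (2 * R) z)\<^sup>2"
      by (intro power_mono) auto
    then have "1 \<le> 16 * eta (2 * R) z"
      by (simp add: eta_eq power2_eq_square)
    then show "X z \<le> 16 * (eta (2 * R) z * X z)"
      using mult_right_mono[of 1 "16 * eta (2 * R) z" "X z"] X_nonneg[of z] by simp
  qed (intro integrable_hbox continuous_intros continuous_eta continuous_X)+
  also have "\<dots> \<le> integral (hbox (2 * R)) (\<lambda>z. 16 * (eta (2 * R) z * X z))"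
    using R by (intro integral_subset_le hbox_mono integrable_hbox continuous_intros continuous_eta continuous_X)
      (auto simp: X_nonneg eta_eq)
  finally show ?thesis by (simp add: E_def)
qed

text \<open>The same estimate with a free Young parameter \<open>d\<close>, applied only outside
  \<open>hbox r\<close>. There the energy contributes just the increment \<open>G R - G r\<close>,
  while the inner box keeps its term with the decaying factor \<open>C / R\<close>.\<close>

lemma E_le_tail:
  assumes r: "0 < r" "r \<le> R" and d: "0 < d"
  shows "E R \<le> (G R - G r) / d + 2 * C\<^sup>2 * d + C / R * integral (hbox r) N"
proof -
  have R: "0 < R" using r by simp
  have C: "0 \<le> C" by (simp add: C_def)
  \<comment> \<open>This is the defect in Young's inequality. Because it is nonnegative, shrinking
    its domain of integration from \<open>hbox R\<close> to \<open>hbox r\<close> replaces an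
    integral over the difference of the boxes.\<close>
  define f where "f z = 1 / d * X z + C\<^sup>2 * d / R\<^sup>2 - C / R * N z" for z
  have f: "0 \<le> f z" for z
  proof -
    have "0 \<le> (N z - C * d / R)\<^sup>2 / (2 * d)" using d by simp
    also have "\<dots> = (N z)\<^sup>2 / (2 * d) + C\<^sup>2 * d / (2 * R\<^sup>2) - C / R * N z"
      using d R by (simp add: power2_eq_square field_simps)
    also have "\<dots> \<le> f z"
    proof -
      have "(N z)\<^sup>2 / (2 * d) \<le> 1 / d * X z"
        using divide_right_mono[OF N_square_le[of z], of "2 * d"] d by simp
      moreover have "C\<^sup>2 * d / (2 * R\<^sup>2) \<le> C\<^sup>2 * d / R\<^sup>2"
        using d R by (intro divide_left_mono) auto
      ultimately show ?thesis unfolding f_def by linarith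
    qed
    finally show ?thesis .
  qed
  have cf: "continuous_on upper f"
    unfolding f_def[abs_def] by (intro continuous_intros continuous_X continuous_N)
  have int_f: "integral (hbox s) f = G s / d + 2 * s * s * (C\<^sup>2 * d / R\<^sup>2) - C / R * integral (hbox s) N" if "0 \<le> s" for s
  proof -
    have "integral (hbox s) f = integral (hbox s) (\<lambda>z. 1 / d * X z + C\<^sup>2 * d / R\<^sup>2) - integral (hbox s) (\<lambda>z. C / R * N z)"
      unfolding f_def[abs_def]
      by (intro integral_diff integrable_hbox continuous_intros continuous_X continuous_N)
    also have "integral (hbox s) (\<lambda>z. 1 / d * X z + C\<^sup>2 * d / R\<^sup>2)
        = integral (hbox s) (\<lambda>z. 1 / d * X z) + integral (hbox s) (\<lambda>z. C\<^sup>2 * d / R\<^sup>2)"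
      by (intro integral_add integrable_hbox continuous_intros continuous_X)
    also have "integral (hbox s) (\<lambda>z. C\<^sup>2 * d / R\<^sup>2) = 2 * s * s * (C\<^sup>2 * d / R\<^sup>2)"
      using content_hbox[OF that] by (simp add: hbox_def)
    finally show ?thesis by (simp add: G_def)
  qed
  have "E R \<le> integral (hbox R) (\<lambda>z. C / R * (K R z * N z))"
    using E_le[OF R] by simp
  also have "\<dots> \<le> integral (hbox R) (\<lambda>z. C / R * N z)"
  proof (rule integral_le)
    fix z assume z: "z \<in> hbox R"
    show "C / R * (K R z * N z) \<le> C / R * N z"
      using K_bounds[OF R z] C R by (intro mult_left_mono mult_left_le_one_le) (auto simp: N_def)
  qed (intro integrable_hbox continuous_intros continuous_KN continuous_N)+
  also have "\<dots> = G R / d + 2 * C\<^sup>2 * d - integral (hbox R) f"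
    using int_f[of R] R by (simp add: power2_eq_square)
  also have "\<dots> \<le> G R / d + 2 * C\<^sup>2 * d - integral (hbox r) f"
    using integral_subset_le[OF hbox_mono[OF r(2)] integrable_hbox[OF cf] integrable_hbox[OF cf]] f by simp
  also have "\<dots> \<le> (G R - G r) / d + 2 * C\<^sup>2 * d + C / R * integral (hbox r) N"
    using int_f[of r] r d by (simp add: diff_divide_distrib)
  finally show ?thesis .
qed

text \<open>Let \<open>L\<close> be the limit of the energies \<open>G\<close>. In the tail estimate
  at scale \<open>2 * k\<close>, first \<open>k\<close> tends to infinity with \<open>n\<close> and
  \<open>d\<close> fixed, then \<open>n\<close>, which removes the increment \<open>L - G n\<close>,
  and finally \<open>d\<close> tends to 0. This leaves \<open>L \<le> 0\<close>.\<close>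

lemma G_eq_0: "G R = 0"
proof -
  have G0: "0 \<le> G r" for r
    unfolding G_def by (rule integral_nonneg) (auto intro: integrable_hbox continuous_X X_nonneg)
  have Gb: "G (real n) \<le> 64 * C\<^sup>2" for n
    \<comment> \<open>Passing to \<open>Suc n\<close> makes the radius positive; the bound is 16 * 4
      * \<open>C^2\<close>.\<close>
    using G_mono[of "real n" "real (Suc n)"] G_le_E[of "real (Suc n)"] E_bounded[of "2 * real (Suc n)"] by simp
  have C0: "(\<lambda>k. C / (2 * real k)) \<longlonglongrightarrow> 0"
    using lim_const_over_n[of "C / 2"] by (simp add: field_simps)
  obtain L where L: "(\<lambda>n. G (real n)) \<longlonglongrightarrow> L" and GL: "\<And>n. G (real n) \<le> L"
  proof (rule incseq_convergent[of "\<lambda>n. G (real n)" "64 * C\<^sup>2"])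
    show "incseq (\<lambda>n. G (real n))" by (simp add: incseq_def G_mono)
  qed (use Gb in auto)
  have "L / 16 \<le> 2 * C\<^sup>2 * d" if d: "0 < d" for d
  proof -
    have "L / 16 \<le> (L - G (real n)) / d + 2 * C\<^sup>2 * d" if n: "0 < n" for n
    proof -
      have "G (real k) / 16 \<le> (G (real (2 * k)) - G (real n)) / d + 2 * C\<^sup>2 * d + C / (2 * real k) * integral (hbox (real n)) N"
        if "n \<le> k" for k
      proof -
        have "G (real k) \<le> 16 * E (2 * real k)"
          using that n by (intro G_le_E) simp
        moreover have "E (2 * real k) \<le> (G (2 * real k) - G (real n)) / d + 2 * C\<^sup>2 * d
            + C / (2 * real k) * integral (hbox (real n)) N"
          using that n d by (intro E_le_tail) auto
        ultimately show ?thesis by (simp only: of_nat_mult of_nat_numeral)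
      qed
      moreover have "(\<lambda>k. G (real (2 * k))) \<longlonglongrightarrow> L"
        using LIMSEQ_subseq_LIMSEQ[OF L, of "\<lambda>k. 2 * k"] by (simp add: strict_mono_def o_def)
      then have "(\<lambda>k. (G (real (2 * k)) - G (real n)) / d + 2 * C\<^sup>2 * d + C / (2 * real k) * integral (hbox (real n)) N)
          \<longlonglongrightarrow> (L - G (real n)) / d + 2 * C\<^sup>2 * d + 0 * integral (hbox (real n)) N"
        using d C0 by (intro tendsto_intros) auto
      moreover have "(\<lambda>k. G (real k) / 16) \<longlonglongrightarrow> L / 16"
        by (intro tendsto_intros L) simp
      ultimately show ?thesis
        by (intro LIMSEQ_le[of "\<lambda>k. G (real k) / 16" "L / 16"
              "\<lambda>k. (G (real (2 * k)) - G (real n)) / d + 2 * C\<^sup>2 * d + C / (2 * real k) * integral (hbox (real n)) N"])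
          (simp, simp, blast)
    qed
    moreover have "(\<lambda>n. (L - G (real n)) / d + 2 * C\<^sup>2 * d) \<longlonglongrightarrow> (L - L) / d + 2 * C\<^sup>2 * d"
      by (intro tendsto_intros L) (use d in simp)
    ultimately show ?thesis
      by (intro LIMSEQ_le_const[of "\<lambda>n. (L - G (real n)) / d + 2 * C\<^sup>2 * d" _ "L / 16"])
         (simp, metis Suc_le_eq)
  qed
  then have "L / 16 \<le> 0"
    by (intro tendsto_lowerbound[of "\<lambda>d. 2 * C\<^sup>2 * d" 0 "at_right 0"])
       (auto intro!: tendsto_eq_intros simp: eventually_at_right_less eventually_at_filter)
  moreover obtain n where "R \<le> real n" using real_arch_simple by blast
  ultimately show ?thesis
    using G_mono[of R "real n"] GL[of n] G0[of R] by linarith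
qed

section \<open>From a vanishing gradient to a shear flow\<close>

lemma A_eq_0:
  assumes "z \<in> upper"
  shows "A1 z = 0" "A2 z = 0"
proof -
  obtain x y where z: "z = (x, y)" "0 \<le> y" using assms by (cases z) (auto simp: upper_def)
  \<comment> \<open>The added 1 keeps the box nondegenerate, as needed to infer that a continuous
    nonnegative function with integral 0 vanishes.\<close>
  define R where "R = \<bar>x\<bar> + y + 1"
  have R: "0 < R" using z by (simp add: R_def)
  have "X z = 0"
  proof (rule has_integral_0_cbox_imp_0[of "(-R, 0)" "(R, R)" X z])
    show "continuous_on (cbox (-R, 0) (R, R)) X"
      using continuous_X by (rule continuous_on_subset) (use hbox_upper[of R] in \<open>simp add: hbox_def\<close>)
    show "(X has_integral 0) (cbox (-R, 0) (R, R))"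
      using G_eq_0[of R] integrable_integral[OF integrable_hbox[OF continuous_X, of R]] by (simp add: G_def hbox_def)
    show "box (-R, 0) (R, R) \<noteq> {}"
      using R by (auto simp: box_ne_empty Basis_prod_def)
    show "z \<in> cbox (-R, 0) (R, R)" using z by (auto simp: R_def cbox_Pair_eq)
  qed (auto simp: X_nonneg)
  then show "A1 z = 0" "A2 z = 0"
    by (auto simp: X_def sum_power2_eq_zero_iff)
qed

text \<open>The quotient \<open>b^2 / q\<close> is the squared sine of the argument of the velocity.
  Its vertical derivative is a multiple of \<open>B2\<close>, hence 0, and its wall value is 0; the
  velocity need not be reconstructed from \<open>phi\<close>.\<close>

lemma b_eq_0:
  assumes "z \<in> upper"
  shows "b z = 0"
proof -
  obtain x y where z: "z = (x, y)" "0 \<le> y" using assms by (cases z) (auto simp: upper_def)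
  note f = C1_upper_divide[OF C1_upper_mult[OF b b] q]
  have q0: "q w \<noteq> 0" if "w \<in> upper" for w using q_pos[OF that] by simp
  note f = f[OF q0]
  have "b (x, y) * b (x, y) / q (x, y) = b (x, 0) * b (x, 0) / q (x, 0)" if "0 < y"
  proof (rule DERIV_isconst_end[OF that])
    show "continuous_on {0..y} (\<lambda>t. b (x, t) * b (x, t) / q (x, t))"
      using continuous_on_slice_y[OF C1_upperD(1)[OF f]] by (rule continuous_on_subset) auto
    fix t assume t: "0 < t" "t < y"
    have up: "(x, t) \<in> upper" using t by (simp add: upper_def)
    have "B2 (x, t) = 0" using A_eq_0(2)[OF up] q_pos[OF up] by (simp add: A2_def)
    then have *: "(b2 (x, t) * b (x, t) + b (x, t) * b2 (x, t)) * q (x, t) - b (x, t) * b (x, t) * q2 (x, t) = 0"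
      unfolding B2_def q_def q2_def by algebra
    then show "((\<lambda>t. b (x, t) * b (x, t) / q (x, t)) has_real_derivative 0) (at t)"
      using C1_upperD(5)[OF f t(1), of x] by (simp only: * div_0)
  qed
  then show ?thesis
    using z q_pos[OF assms] wall[of x] by (cases "y = 0") auto
qed

lemma a_shear:
  assumes "0 \<le> y"
  shows "a (x, y) = a (x', y)"
proof -
  have "b2 w = 0" if "0 < snd w" for w
  proof -
    have "((\<lambda>t. b (fst w, t)) has_real_derivative 0) (at (snd w))"
      by (rule has_field_derivative_transform_within_open[where S="{0<..}" and f="\<lambda>_. 0"])
         (use that b_eq_0 in \<open>auto simp: upper_def\<close>)
    then show ?thesis
      using DERIV_unique C1_upperD(5)[OF b that, of "fst w"] by fastforce
  qed
  then have "b2 w = 0" if "w \<in> upper" for w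
    using eq_on_upper[OF C1_upperD(3)[OF b], of "\<lambda>_. 0"] that by auto
  then have "a1 (s, y) = 0" for s
    using div0[of "(s, y)"] assms by (simp add: upper_def)
  then show ?thesis
    using DERIV_isconst_all[of "\<lambda>s. a (s, y)" x x'] C1_upperD(4)[OF a assms] by metis
qed

text \<open>With \<open>b = 0\<close>, positivity of \<open>q\<close> says that \<open>a\<close> has
  no zero, and the closed half plane is connected.\<close>

lemma a_sign: "(\<forall>z\<in>upper. 0 < a z) \<or> (\<forall>z\<in>upper. a z < 0)"
proof (rule ccontr)
  assume contr: "\<not> ?thesis"
  have nz: "a z \<noteq> 0" if "z \<in> upper" for z
    using q_pos[OF that] b_eq_0[OF that] by (auto simp: q_def)
  have "convex upper"
    by (auto simp: upper_def convex_def)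
  then have "connected (a ` upper)"
    by (intro connected_continuous_image C1_upperD(1)[OF a] convex_connected)
  moreover obtain z w where "z \<in> upper" "w \<in> upper" "a z \<le> 0" "0 \<le> a w"
    using contr by force
  ultimately have "0 \<in> a ` upper"
    using connectedD_interval[of "a ` upper" "a z" "a w" 0] by blast
  then show False using nz by auto
qed

end

subsection \<open>Passage to vectors\<close>

text \<open>The calculus above runs on pairs, where integrals over boxes are iterated integrals;
  this map identifies pairs with vectors.\<close>

definition plane_vec :: "real \<times> real \<Rightarrow> real ^ 2"
  where "plane_vec z = fst z *\<^sub>R axis 1 1 + snd z *\<^sub>R axis 2 1"

lemma plane_vec_nth: "plane_vec z $ 1 = fst z" "plane_vec z $ 2 = snd z"
  by (auto simp: plane_vec_def axis_def)

lemma plane_vec_surj: "plane_vec (x $ 1, x $ 2) = x"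
  by (simp add: vec_eq_iff forall_2 plane_vec_nth)

lemma plane_vec_mem:
  "plane_vec z \<in> half_plane \<longleftrightarrow> 0 < snd z" "plane_vec z \<in> closure half_plane \<longleftrightarrow> z \<in> upper"
  by (auto simp: half_plane_def closure_half_plane plane_vec_nth upper_def)

lemma continuous_on_plane_vec:
  assumes "continuous_on (closure half_plane) f"
  shows "continuous_on upper (\<lambda>z. f (plane_vec z))"
proof (rule continuous_on_compose2[OF assms])
  show "continuous_on upper plane_vec"
    unfolding plane_vec_def[abs_def] by (intro continuous_intros)
qed (auto simp: plane_vec_mem)

lemma partial_deriv_plane_vec:
  assumes "partial_differentiable 1 f (plane_vec (x, y))"
  shows "((\<lambda>s. f (plane_vec (s, y))) has_real_derivative partial_deriv 1 f (plane_vec (x, y))) (at x)"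
proof -
  have "((\<lambda>t. f (plane_vec (x, y) + t *\<^sub>R axis 1 1)) has_real_derivative partial_deriv 1 f (plane_vec (x, y))) (at 0)"
    using assms unfolding partial_differentiable_def partial_deriv_def
    by (simp add: DERIV_deriv_iff_field_differentiable)
  moreover have "plane_vec (x, y) + t *\<^sub>R axis 1 1 = plane_vec (t + x, y)" for t
    by (simp add: plane_vec_def algebra_simps)
  ultimately show ?thesis
    using DERIV_shift[of "\<lambda>s. f (plane_vec (s, y))" _ 0 x] by simp
qed

lemma partial_deriv_plane_vec':
  assumes "partial_differentiable 2 f (plane_vec (x, y))"
  shows "((\<lambda>t. f (plane_vec (x, t))) has_real_derivative partial_deriv 2 f (plane_vec (x, y))) (at y)"
proof -
  have "((\<lambda>t. f (plane_vec (x, y) + t *\<^sub>R axis 2 1)) has_real_derivative partial_deriv 2 f (plane_vec (x, y))) (at 0)"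
    using assms unfolding partial_differentiable_def partial_deriv_def
    by (simp add: DERIV_deriv_iff_field_differentiable)
  moreover have "plane_vec (x, y) + t *\<^sub>R axis 2 1 = plane_vec (x, t + y)" for t
    by (simp add: plane_vec_def algebra_simps)
  ultimately show ?thesis
    using DERIV_shift[of "\<lambda>t. f (plane_vec (x, t))" _ 0 y] by simp
qed

lemma Ck_closure_imp_continuous: "Ck_closure k U f \<Longrightarrow> continuous_on (closure U) f"
  by (cases k) auto

text \<open>The continuous extensions provided by \<open>Ck_closure\<close> serve as derivatives up
  to the wall, where \<open>partial_deriv\<close> itself could depend on irrelevant values of
  \<open>f\<close> outside the closed half plane.\<close>

lemma Ck_closure_Suc_half_plane:
  assumes "Ck_closure (Suc k) half_plane f"
  obtains g h where "Ck_closure k half_plane g" "Ck_closure k half_plane h"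
    "\<And>x. x \<in> half_plane \<Longrightarrow> g x = partial_deriv 1 f x" "\<And>x. x \<in> half_plane \<Longrightarrow> h x = partial_deriv 2 f x"
    "C1_upper (\<lambda>z. f (plane_vec z)) (\<lambda>z. g (plane_vec z)) (\<lambda>z. h (plane_vec z))"
proof -
  from assms obtain g h where g: "Ck_closure k half_plane g" "\<And>x. x \<in> half_plane \<Longrightarrow> g x = partial_deriv 1 f x"
    and h: "Ck_closure k half_plane h" "\<And>x. x \<in> half_plane \<Longrightarrow> h x = partial_deriv 2 f x"
    by auto metis
  have pd: "partial_differentiable i f x" if "x \<in> half_plane" for i x
    using assms that by simp
  have "C1_upper (\<lambda>z. f (plane_vec z)) (\<lambda>z. g (plane_vec z)) (\<lambda>z. h (plane_vec z))"
  proof (rule C1_upperI)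
    fix x y :: real assume "0 < y"
    then have m: "plane_vec (x, y) \<in> half_plane" by (simp add: plane_vec_mem)
    show "((\<lambda>s. f (plane_vec (s, y))) has_real_derivative g (plane_vec (x, y))) (at x)"
      using partial_deriv_plane_vec[OF pd[OF m]] g(2)[OF m] by simp
    show "((\<lambda>t. f (plane_vec (x, t))) has_real_derivative h (plane_vec (x, y))) (at y)"
      using partial_deriv_plane_vec'[OF pd[OF m]] h(2)[OF m] by simp
  qed (use assms g(1) h(1) in \<open>auto intro!: continuous_on_plane_vec intro: Ck_closure_imp_continuous\<close>)
  with g h that show ?thesis by blast
qed

lemma norm_bounds_half_plane:
  fixes v :: "real ^ 2 \<Rightarrow> real ^ 2"
  assumes "0 < (INF x\<in>half_plane. ereal (norm (v x)))" and "(SUP x\<in>half_plane. ereal (norm (v x))) < \<infinity>"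
  obtains m M where "0 < m" "\<And>x. x \<in> half_plane \<Longrightarrow> m \<le> norm (v x)" "\<And>x. x \<in> half_plane \<Longrightarrow> norm (v x) \<le> M"
proof -
  \<comment> \<open>A real number strictly between 0 and the extended infimum is a uniform lower
    bound; likewise \<open>M\<close> is chosen strictly above the supremum.\<close>
  obtain m where m: "0 < ereal m" "ereal m < (INF x\<in>half_plane. ereal (norm (v x)))"
    using ereal_dense2[OF assms(1)] by blast
  obtain M where M: "(SUP x\<in>half_plane. ereal (norm (v x))) < ereal M"
    using ereal_dense2[OF assms(2)] by blast
  show ?thesis
  proof (rule that[of m M])
    show "0 < m" using m by simp
    fix x assume "x \<in> half_plane"
    then show "m \<le> norm (v x)" "norm (v x) \<le> M"
      using less_INF_D[OF m(2)] SUP_lessD[OF M] by fastforce+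
  qed
qed

theorem theorem1p3:
  fixes v :: "real ^ 2 \<Rightarrow> real ^ 2" and p :: "real ^ 2 \<Rightarrow> real"
  assumes "\<And>i. Ck_closure 2 half_plane (\<lambda>x. v x $ i)"
    and "steady_euler half_plane v p"
    and "\<And>x. x \<in> frontier half_plane \<Longrightarrow> v x $ 2 = 0"
    and "0 < (INF x\<in>half_plane. ereal (norm (v x)))"
    and "(SUP x\<in>half_plane. ereal (norm (v x))) < \<infinity>"
  shows "shear_flow_on (closure half_plane) v \<and>
         ((\<forall>x\<in>closure half_plane. v x $ 1 > 0) \<or> (\<forall>x\<in>closure half_plane. v x $ 1 < 0))"
proof -
  have C2: "Ck_closure (Suc (Suc 0)) half_plane (\<lambda>x. v x $ i)" for i
    using assms(1)[of i] by (simp only: numeral_2_eq_2)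
  obtain ax ay where a': "Ck_closure (Suc 0) half_plane ax" "Ck_closure (Suc 0) half_plane ay"
      "\<And>x. x \<in> half_plane \<Longrightarrow> ax x = partial_deriv 1 (\<lambda>x. v x $ 1) x"
      "\<And>x. x \<in> half_plane \<Longrightarrow> ay x = partial_deriv 2 (\<lambda>x. v x $ 1) x"
    and a: "C1_upper (\<lambda>z. v (plane_vec z) $ 1) (\<lambda>z. ax (plane_vec z)) (\<lambda>z. ay (plane_vec z))"
    by (rule Ck_closure_Suc_half_plane[OF C2[of 1]]) (rule that)
  obtain bx b_y where b': "Ck_closure (Suc 0) half_plane bx" "Ck_closure (Suc 0) half_plane b_y"
      "\<And>x. x \<in> half_plane \<Longrightarrow> bx x = partial_deriv 1 (\<lambda>x. v x $ 2) x"
      "\<And>x. x \<in> half_plane \<Longrightarrow> b_y x = partial_deriv 2 (\<lambda>x. v x $ 2) x"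
    and b: "C1_upper (\<lambda>z. v (plane_vec z) $ 2) (\<lambda>z. bx (plane_vec z)) (\<lambda>z. b_y (plane_vec z))"
    by (rule Ck_closure_Suc_half_plane[OF C2[of 2]]) (rule that)
  obtain axx axy where a1: "C1_upper (\<lambda>z. ax (plane_vec z)) (\<lambda>z. axx (plane_vec z)) (\<lambda>z. axy (plane_vec z))"
    by (rule Ck_closure_Suc_half_plane[OF a'(1)]) (rule that)
  obtain ayx ayy where a2: "C1_upper (\<lambda>z. ay (plane_vec z)) (\<lambda>z. ayx (plane_vec z)) (\<lambda>z. ayy (plane_vec z))"
    by (rule Ck_closure_Suc_half_plane[OF a'(2)]) (rule that)
  obtain bxx bxy where b1: "C1_upper (\<lambda>z. bx (plane_vec z)) (\<lambda>z. bxx (plane_vec z)) (\<lambda>z. bxy (plane_vec z))"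
    by (rule Ck_closure_Suc_half_plane[OF b'(1)]) (rule that)
  obtain byx byy where b2: "C1_upper (\<lambda>z. b_y (plane_vec z)) (\<lambda>z. byx (plane_vec z)) (\<lambda>z. byy (plane_vec z))"
    by (rule Ck_closure_Suc_half_plane[OF b'(2)]) (rule that)
  obtain m M where m: "0 < m" "\<And>x. x \<in> half_plane \<Longrightarrow> m \<le> norm (v x)"
    and M: "\<And>x. x \<in> half_plane \<Longrightarrow> norm (v x) \<le> M"
    by (rule norm_bounds_half_plane[OF assms(4,5)]) (rule that)
  have norm_v: "v x $ 1 * v x $ 1 + v x $ 2 * v x $ 2 = (norm (v x))\<^sup>2" for x
    unfolding power2_norm_eq_inner inner_vec_def by (simp add: sum_2)
  have cq: "continuous_on upper (\<lambda>z. v (plane_vec z) $ 1 * v (plane_vec z) $ 1 + v (plane_vec z) $ 2 * v (plane_vec z) $ 2)"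
    by (intro continuous_intros C1_upperD(1)[OF a] C1_upperD(1)[OF b])
  have euler: "partial_differentiable i p x" "divergence v x = 0"
      "partial_deriv i p x = - (v x $ 1 * partial_deriv 1 (\<lambda>y. v y $ i) x + v x $ 2 * partial_deriv 2 (\<lambda>y. v y $ i) x)"
    if "x \<in> half_plane" for i x
  proof -
    have e: "advection v x + gradient p x = 0" and "partial_differentiable i p x" "divergence v x = 0"
      using assms(2) that by (auto simp: steady_euler_def)
    then show "partial_differentiable i p x" "divergence v x = 0" by auto
    have "advection v x $ i + gradient p x $ i = 0" using e by (metis vector_add_component zero_index)
    then show "partial_deriv i p x = - (v x $ 1 * partial_deriv 1 (\<lambda>y. v y $ i) x + v x $ 2 * partial_deriv 2 (\<lambda>y. v y $ i) x)"
      by (simp add: advection_def gradient_def sum_2)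
  qed
  interpret euler_half_plane
    "\<lambda>z. v (plane_vec z) $ 1" "\<lambda>z. ax (plane_vec z)" "\<lambda>z. ay (plane_vec z)"
    "\<lambda>z. axx (plane_vec z)" "\<lambda>z. axy (plane_vec z)" "\<lambda>z. ayx (plane_vec z)" "\<lambda>z. ayy (plane_vec z)"
    "\<lambda>z. v (plane_vec z) $ 2" "\<lambda>z. bx (plane_vec z)" "\<lambda>z. b_y (plane_vec z)"
    "\<lambda>z. bxx (plane_vec z)" "\<lambda>z. bxy (plane_vec z)" "\<lambda>z. byx (plane_vec z)" "\<lambda>z. byy (plane_vec z)"
    "\<lambda>z. p (plane_vec z)" m M
  proof (standard, goal_cases)
    case (7 z)
    show ?case
    proof (rule eq_on_upper[OF C1_upperD(3)[OF b] continuous_on_minus[OF C1_upperD(2)[OF a]] _ 7])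
      fix z :: "real \<times> real" assume "0 < snd z"
      then have h: "plane_vec z \<in> half_plane" by (simp add: plane_vec_mem)
      show "b_y (plane_vec z) = - ax (plane_vec z)"
        using euler(2)[OF h] a'(3)[OF h] b'(4)[OF h] by (simp add: divergence_def sum_2)
    qed
  next
    case (8 x y)
    then have h: "plane_vec (x, y) \<in> half_plane" by (simp add: plane_vec_mem)
    show ?case
      using partial_deriv_plane_vec[OF euler(1)[OF h]] euler(3)[OF h, of 1] a'(3,4)[OF h] by simp
  next
    case (9 x y)
    then have h: "plane_vec (x, y) \<in> half_plane" by (simp add: plane_vec_mem)
    show ?case
      using partial_deriv_plane_vec'[OF euler(1)[OF h]] euler(3)[OF h, of 2] b'(3,4)[OF h] by simp
  next
    case (10 x)
    show ?case by (rule assms(3)) (simp add: frontier_half_plane plane_vec_nth)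
  next
    case (12 z)
    show ?case
    proof (rule ge_on_upper[OF cq _ 12])
      fix z :: "real \<times> real" assume "0 < snd z"
      then show "m\<^sup>2 \<le> v (plane_vec z) $ 1 * v (plane_vec z) $ 1 + v (plane_vec z) $ 2 * v (plane_vec z) $ 2"
        unfolding norm_v using m by (intro power_mono) (auto simp: plane_vec_mem)
    qed
  next
    case (13 z)
    \<comment> \<open>Negation turns the upper bound into a lower one, to which the extension to the
      wall applies.\<close>
    have "- (M\<^sup>2) \<le> - (v (plane_vec z) $ 1 * v (plane_vec z) $ 1 + v (plane_vec z) $ 2 * v (plane_vec z) $ 2)"
    proof (rule ge_on_upper[OF continuous_on_minus[OF cq] _ 13])
      fix z :: "real \<times> real" assume "0 < snd z"
      then show "- (M\<^sup>2) \<le> - (v (plane_vec z) $ 1 * v (plane_vec z) $ 1 + v (plane_vec z) $ 2 * v (plane_vec z) $ 2)"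
        unfolding norm_v neg_le_iff_le using M by (intro power_mono) (auto simp: plane_vec_mem)
    qed
    then show ?case by simp
  qed (fact a a1 a2 b b1 b2 m(1))+
  have mem: "(x $ 1, x $ 2) \<in> upper" if "x \<in> closure half_plane" for x
    using that by (simp add: closure_half_plane upper_def)
  have "v x $ 2 = 0" if "x \<in> closure half_plane" for x
    using b_eq_0[OF mem[OF that]] by (simp add: plane_vec_surj)
  moreover have "v x $ 1 = v (plane_vec (0, x $ 2)) $ 1" if "x \<in> closure half_plane" for x
    using a_shear[of "x $ 2" "x $ 1" 0] that by (simp add: plane_vec_surj closure_half_plane)
  ultimately have "shear_flow_on (closure half_plane) v"
    unfolding shear_flow_on_def by (intro conjI ballI exI[of _ "\<lambda>y. v (plane_vec (0, y)) $ 1"]) auto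
  moreover have "(\<forall>x\<in>closure half_plane. v x $ 1 > 0) \<or> (\<forall>x\<in>closure half_plane. v x $ 1 < 0)"
    using a_sign mem by (metis plane_vec_surj)
  ultimately show ?thesis ..
qed

end
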